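(* Let $a\geq 1$ and $k\geq 5$ be integers with $k$ odd, and let $b=ak+2$. Let $T$ be a tree with $k$ interior vertices and $b$ leaves. Then $$\lambda_1(T)\ \leq\ \lambda_1\left(SLP\left(a+1,a;2;\tfrac{k-3}{2},\tfrac{k-3}{2}\right)\right).$$ Equality holds if and only if $T$ is (isomorphic to) the star-like path tree $SLP\left(a+1,a;2;\frac{k-3}{2},\frac{k-3}{2}\right)$.
   Context: For a finite tree $T=(V,E)$ with at least three vertices, the boundary $B$ is the set of leaves (degree-one vertices) and the interior is $\Omega=V\setminus B$; interior vertices are the non-leaf vertices. The first Dirichlet eigenvalue $\lambda_1(T)$ is the smallest $\lambda$ for which there is a nonzero $f:V\to\mathbb{R}$ with $f=0$ on $B$ and $\sum_{y\sim x}(f(x)-f(y))=\lambda f(x)$ for all $x\in\Omega$. Star-like path tree: for integers $q\geq1$ and $p,c,d,e\geq 0$, $SLP(p,q;c;d,e)$ is the tree obtained as follows. Take a path $u_0\sim u_1\sim\cdots\sim u_c$ of length $c$ (a single vertex $u_0=u_c$ if $c=0$). Attach $d$ new vertices $u_{0,1},\dots,u_{0,d}$ to $u_0$ and $e$ new vertices $u_{c,1},\dots,u_{c,e}$ to $u_c$. Then attach $p$ leaves to each vertex of the set $\{u_0,u_c\}$, and attach $q$ leaves to each of the vertices $u_{0,i}$ ($1\le i\le d$), $u_{c,j}$ ($1\le j\le e$), and $u_1,\dots,u_{c-1}$. *)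

theory Defs
  imports Complex_Main "Graph_Theory.Graph_Theory"
begin

text \<open>
  Graphs are finite simple graphs in the sense of \<^locale>\<open>pair_graph\<close>: every edge occurs
  as two opposite arcs. Hence \<open>x, y, x\<close> is a cycle for \<^const>\<open>pre_digraph.cycle\<close>, and
  the library predicates \<open>forest\<close> and \<open>tree\<close>, which forbid it, are not the undirected
  notions. A cycle of an undirected graph is a \<^const>\<open>pre_digraph.cycle\<close> of length at least 3.
\<close>

definition undirected_tree :: "'v pair_pre_digraph \<Rightarrow> bool" where
  "undirected_tree T \<longleftrightarrow>
     pair_graph T \<and> Digraph_Component.connected (with_proj T) \<and>
     \<not> (\<exists>p. pre_digraph.cycle (with_proj T) p \<and> 3 \<le> length p)"

text \<open>In a symmetric digraph without multiple arcs, the out-degree is the undirected degree.\<close>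

definition leaf_verts :: "'v pair_pre_digraph \<Rightarrow> 'v set" where
  "leaf_verts T = {x \<in> pverts T. out_degree (with_proj T) x = 1}"

definition interior_verts :: "'v pair_pre_digraph \<Rightarrow> 'v set" where
  "interior_verts T = pverts T - leaf_verts T"

text \<open>Only the restriction of \<open>f\<close> to \<^term>\<open>pverts T\<close> matters.\<close>

definition dirichlet_eigenvalue :: "'v pair_pre_digraph \<Rightarrow> real \<Rightarrow> bool" where
  "dirichlet_eigenvalue T lam \<longleftrightarrow>
     (\<exists>f :: 'v \<Rightarrow> real.
        (\<exists>x \<in> pverts T. f x \<noteq> 0) \<and>
        (\<forall>x \<in> leaf_verts T. f x = 0) \<and>
        (\<forall>x \<in> interior_verts T. (\<Sum>y | (x, y) \<in> parcs T. f x - f y) = lam * f x))"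

definition first_dirichlet_eigenvalue :: "'v pair_pre_digraph \<Rightarrow> real" where
  "first_dirichlet_eigenvalue T = (LEAST lam. dirichlet_eigenvalue T lam)"

text \<open>
  Vertices of the star-like path trees: \<open>Spine i\<close> is $u_i$, \<open>ArmL i\<close> is $u_{0,i}$,
  \<open>ArmR j\<close> is $u_{c,j}$, and \<open>Pendant v i\<close> is the \<open>i\<close>-th leaf attached to \<open>v\<close> in
  the last step of the construction.
\<close>

datatype slp_vertex = Spine nat | ArmL nat | ArmR nat | Pendant slp_vertex nat

definition slp_core :: "nat \<Rightarrow> nat \<Rightarrow> nat \<Rightarrow> slp_vertex set" where
  "slp_core c d e = Spine ` {0..c} \<union> ArmL ` {1..d} \<union> ArmR ` {1..e}"

definition slp_pendants :: "nat \<Rightarrow> nat \<Rightarrow> nat \<Rightarrow> slp_vertex \<Rightarrow> nat" where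
  "slp_pendants p q c v = (if v \<in> {Spine 0, Spine c} then p else q)"

text \<open>One orientation of each edge.\<close>

definition slp_edges :: "nat \<Rightarrow> nat \<Rightarrow> nat \<Rightarrow> nat \<Rightarrow> nat \<Rightarrow> slp_vertex rel" where
  "slp_edges p q c d e =
     {(Spine i, Spine (Suc i)) | i. i < c} \<union>
     {(Spine 0, ArmL i) | i. i \<in> {1..d}} \<union>
     {(Spine c, ArmR j) | j. j \<in> {1..e}} \<union>
     {(v, Pendant v i) | v i. v \<in> slp_core c d e \<and> i \<in> {1..slp_pendants p q c v}}"

definition SLP :: "nat \<Rightarrow> nat \<Rightarrow> nat \<Rightarrow> nat \<Rightarrow> nat \<Rightarrow> slp_vertex pair_pre_digraph" where
  "SLP p q c d e =
     \<lparr> pverts = slp_core c d e \<union>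
         {Pendant v i | v i. v \<in> slp_core c d e \<and> i \<in> {1..slp_pendants p q c v}},
       parcs = slp_edges p q c d e \<union> (slp_edges p q c d e)\<inverse> \<rparr>"

end

theory Submission
  imports Defs "HOL-Analysis.Function_Topology"
begin

text \<open>
  Restricted to the tree of interior vertices, the Dirichlet Laplacian is the graph Laplacian plus the
  diagonal matrix of the numbers of leaves \<open>w\<close>. Put \<open>v = w - a\<close>, an integer
  function of total mass 2, and let \<open>f > 0\<close> be the ground state of Laplacian plus \<open>v\<close>, with
  eigenvalue \<open>l\<close>. Dividing the eigenvalue equation by \<open>f x\<close> and summing over a vertex set \<open>S\<close> gives
  the mass of \<open>S\<close> as \<open>l * card S\<close>, plus a nonnegative cost \<open>f y / f x + f x / f y - 2\<close> for each edge
  inside \<open>S\<close>, plus \<open>f y / f x - 1\<close> for each edge leaving \<open>S\<close>. For \<open>S\<close> the whole tree this reads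
  \<open>2 = l * k + total cost\<close>, so \<open>l\<close> is large only if the edges are cheap.

  An edge one of whose sides has mass at most 0 costs at least \<open>psi l\<close>, where
  \<open>psi s = s\<^sup>2 / (1 - s)\<close>. As masses are integers, a cheaper edge splits the mass as \<open>1 + 1\<close>. There are
  at most two such edges, and by convexity of \<open>psi\<close> two of them cost at least \<open>2 * psi (l / 2)\<close> together. Hence
  \<open>l * k + (k - 3) * psi l + 2 * psi (l / 2) \<le> 2\<close>, and the left-hand side is strictly increasing in \<open>l\<close>.
  The star-like path tree has an explicit positive eigenvector whose eigenvalue attains equality.
  Conversely, equality forces two cheap edges at a common vertex, and every other edge to cut off a single
  vertex of mass 0.
\<close>

section \<open>Trees as connected graphs all of whose edges are bridges\<close>

text \<open>Demanding that every edge be a bridge, instead of forbidding cycles, makes the two sides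
  of an edge available at once and passes to connected subgraphs by monotonicity of
  reachability.\<close>

locale bridge_graph =
  fixes V :: "'v set" and A :: "'v rel"
  assumes fin: "finite V" and sub: "A \<subseteq> V \<times> V" and sym: "(x, y) \<in> A \<Longrightarrow> (y, x) \<in> A"
    and conn: "x \<in> V \<Longrightarrow> y \<in> V \<Longrightarrow> (x, y) \<in> A\<^sup>*"
    and bridge: "(x, y) \<in> A \<Longrightarrow> (x, y) \<notin> (A - {(x, y), (y, x)})\<^sup>*"
begin

text \<open>Convention: the arc \<open>(x, y)\<close> points out of \<open>side x y\<close>, the
  component of \<open>x\<close> once the edge is deleted.\<close>

definition side :: "'v \<Rightarrow> 'v \<Rightarrow> 'v set" where
  "side x y = {z. (x, z) \<in> (A - {(x, y), (y, x)})\<^sup>*}"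

lemma arcD: "(x, y) \<in> A \<Longrightarrow> x \<in> V" "(x, y) \<in> A \<Longrightarrow> y \<in> V"
  using sub by auto

lemma irrefl: "(x, y) \<in> A \<Longrightarrow> x \<noteq> y"
  using bridge by blast

lemma fin_A: "finite A"
  using fin sub finite_subset by blast

lemma side_self: "x \<in> side x y"
  by (simp add: side_def)

lemma side_other: "(x, y) \<in> A \<Longrightarrow> y \<notin> side x y"
  using bridge by (simp add: side_def)

lemma side_sub: "x \<in> V \<Longrightarrow> side x y \<subseteq> V"
proof
  fix z assume "x \<in> V" "z \<in> side x y"
  from this(2) have "(x, z) \<in> (A - {(x, y), (y, x)})\<^sup>*" by (simp add: side_def)
  then show "z \<in> V" using \<open>x \<in> V\<close> arcD by (induction) auto
qed

lemma fin_side: "x \<in> V \<Longrightarrow> finite (side x y)"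
  using side_sub fin finite_subset by blast

text \<open>An arc that starts in the side cannot start at \<open>y\<close>, so it survives the
  deletion unless it is \<open>(x, y)\<close> itself. The inductions along walks below rest on
  this.\<close>

lemma side_step:
  assumes "(x, y) \<in> A" "z \<in> side x y" "(z, w) \<in> A"
  shows "w \<in> side x y \<longleftrightarrow> (z, w) \<noteq> (x, y)"
proof
  show "w \<in> side x y \<Longrightarrow> (z, w) \<noteq> (x, y)" using side_other assms by auto
next
  assume "(z, w) \<noteq> (x, y)"
  moreover have "z \<noteq> y" using side_other assms by auto
  ultimately have "(z, w) \<in> A - {(x, y), (y, x)}" using assms by auto
  with assms(2) show "w \<in> side x y"
    unfolding side_def by (auto intro: rtrancl_into_rtrancl)
qed

lemma side_cover:
  assumes "(x, y) \<in> A" "z \<in> V"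
  shows "z \<in> side x y \<union> side y x"
proof -
  have "(x, z) \<in> A\<^sup>*" using conn assms arcD by blast
  then show ?thesis
  proof induction
    case base then show ?case by (simp add: side_self)
  next
    case (step z w)
    then show ?case
      using side_step[OF assms(1), of z w] side_step[OF sym[OF assms(1)], of z w] side_self by auto
  qed
qed

lemma side_disjoint:
  assumes "(x, y) \<in> A"
  shows "side x y \<inter> side y x = {}"
proof (rule ccontr)
  let ?R = "A - {(x, y), (y, x)}"
  assume "side x y \<inter> side y x \<noteq> {}"
  then obtain z where z: "(x, z) \<in> ?R\<^sup>*" "(y, z) \<in> ?R\<^sup>*"
    by (auto simp: side_def insert_commute)
  have "Relation.sym ?R" using sym by (auto simp: Relation.sym_def)
  then have "(z, y) \<in> ?R\<^sup>*" using z(2) by (meson sym_rtrancl symE)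
  then show False using z(1) bridge[OF assms] by (meson rtrancl_trans)
qed

lemma side_rev: "(x, y) \<in> A \<Longrightarrow> side y x = V - side x y"
  using side_cover side_disjoint side_sub arcD by blast

text \<open>A walk inside \<open>side x y\<close> never meets \<open>y'\<close>, which lies on the
  opposite side. Hence it cannot use the arc \<open>(y', x')\<close>, the only exit from
  \<open>side y' x'\<close>.\<close>

lemma side_mono:
  assumes "(x, y) \<in> A" "(x', y') \<in> A" "x \<in> side y' x'" "y' \<in> side y x"
  shows "side x y \<subseteq> side y' x'"
proof
  fix z assume "z \<in> side x y"
  then have "(x, z) \<in> (A - {(x, y), (y, x)})\<^sup>*" by (simp add: side_def)
  then have "z \<in> side x y \<and> z \<in> side y' x'"
  proof induction
    case base then show ?case using assms(3) by (simp add: side_self)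
  next
    case (step z w)
    have "z \<noteq> y'" using step.IH assms(4) side_disjoint[OF assms(1)] by auto
    then show ?case
      using step side_step[OF assms(1), of z w] side_step[OF sym[OF assms(2)], of z w] by auto
  qed
  then show "z \<in> side y' x'" by simp
qed

lemma arc_in_side:
  assumes "(x, y) \<in> A" "(p, q) \<in> A" "(p, q) \<noteq> (x, y)" "(p, q) \<noteq> (y, x)"
  shows "p \<in> side x y \<and> q \<in> side x y \<or> p \<in> side y x \<and> q \<in> side y x"
  using side_cover[OF assms(1), of p] side_step[OF assms(1), of p q]
    side_step[OF sym[OF assms(1)], of p q] assms arcD by auto

text \<open>Each of two different edges lies entirely on one side of the other. Orient both so that
  they point towards each other; then the sides behind them are disjoint.\<close>

lemma disjoint_orientation:
  assumes "(x, y) \<in> A" "(p, q) \<in> A" "(p, q) \<noteq> (x, y)" "(p, q) \<noteq> (y, x)"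
  obtains x' y' p' q' where "(x', y') = (x, y) \<or> (x', y') = (y, x)"
    "(p', q') = (p, q) \<or> (p', q') = (q, p)" "side x' y' \<inter> side p' q' = {}"
proof -
  obtain x' y' where e: "(x', y') = (x, y) \<or> (x', y') = (y, x)" "p \<in> side y' x'" "q \<in> side y' x'"
    using arc_in_side[OF assms] by blast
  then have A': "(x', y') \<in> A" using assms(1) sym by auto
  obtain p' q' where e': "(p', q') = (p, q) \<or> (p', q') = (q, p)" "x' \<in> side q' p'"
    using arc_in_side[OF assms(2,1)] assms(3,4) e(1) by blast
  then have A'': "(p', q') \<in> A" using assms(2) sym by auto
  have "side x' y' \<subseteq> side q' p'"
    using side_mono[OF A' A'' e'(2)] e e' by auto
  then show thesis using that[OF e(1) e'(1)] side_disjoint[OF A''] by auto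
qed

lemma disjoint_heads:
  assumes "(x, y) \<in> A" "(p, q) \<in> A" "side x y \<inter> side p q = {}" "(p, q) \<noteq> (y, x)"
  shows "y \<notin> side p q"
proof
  assume "y \<in> side p q"
  then have "x \<in> side p q" using side_step[OF assms(2) _ sym[OF assms(1)]] assms(4) by auto
  then show False using side_self assms(3) by auto
qed

lemma in_branch:
  assumes "x \<in> V" "z \<in> V" "z \<noteq> x"
  obtains p where "(x, p) \<in> A" "z \<in> side p x"
proof -
  have "(x, z) \<in> A\<^sup>*" using conn assms by blast
  then have "z = x \<or> (\<exists>p. (x, p) \<in> A \<and> z \<in> side p x)"
  proof induction
    case base then show ?case by simp
  next
    case (step z w)
    show ?case
    proof (cases "z = x")
      case True then show ?thesis using step side_self by auto
    next
      case False
      then obtain p where p: "(x, p) \<in> A" "z \<in> side p x" using step by auto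
      then show ?thesis using side_step[OF sym[OF p(1)] p(2) step(2)] by auto
    qed
  qed
  then show thesis using assms that by auto
qed

text \<open>Root the tree at some \<open>r\<close>: every other vertex has an arc towards
  \<open>r\<close>. No such arc is the reversal of another, whence the factor 2.\<close>

lemma card_arcs: "2 * (card V - 1) \<le> card A"
proof (cases "V = {}")
  case False
  then obtain r where r: "r \<in> V" by auto
  define P where "P = {(x, y) \<in> A. r \<in> side y x}"
  have "V - {r} \<subseteq> fst ` P"
  proof
    fix x assume "x \<in> V - {r}"
    then obtain p where "(x, p) \<in> A" "r \<in> side p x" using in_branch[of x r] r by auto
    then show "x \<in> fst ` P" unfolding P_def by force
  qed
  moreover have finP: "finite P" using fin_A by (rule finite_subset[rotated]) (auto simp: P_def)
  ultimately have "card V - 1 \<le> card P"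
    using surj_card_le[of P "V - {r}" fst] fin r by simp
  moreover have "P \<inter> P\<inverse> = {}" using side_disjoint unfolding P_def by fastforce
  then have "card (P \<union> P\<inverse>) = card P + card P" using finP by (simp add: card_Un_disjoint)
  moreover have "card (P \<union> P\<inverse>) \<le> card A"
    by (rule card_mono[OF fin_A]) (auto simp: P_def sym)
  ultimately show ?thesis by linarith
qed simp

end

section \<open>The cost of an edge\<close>

text \<open>For \<open>s = 1 - f x / f y\<close> this equals
  \<open>f y / f x + f x / f y - 2\<close>, the cost of the edge between \<open>x\<close> and
  \<open>y\<close>.\<close>

definition psi :: "real \<Rightarrow> real" where
  "psi s = s\<^sup>2 / (1 - s)"

lemma psi_alt: "s < 1 \<Longrightarrow> psi s = 1 / (1 - s) - 1 - s"
  by (simp add: psi_def field_simps power2_eq_square)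

lemma psi_nonneg: "s < 1 \<Longrightarrow> 0 \<le> psi s"
  by (simp add: psi_def)

lemma psi_strict_mono:
  assumes "0 \<le> s" "s < t" "t < 1"
  shows "psi s < psi t"
proof -
  have "s\<^sup>2 < t\<^sup>2" using assms by (simp add: power_strict_mono)
  then have "s\<^sup>2 / (1 - s) < t\<^sup>2 / (1 - s)" using assms by (simp add: divide_strict_right_mono)
  also have "\<dots> \<le> t\<^sup>2 / (1 - t)" using assms by (intro divide_left_mono) auto
  finally show ?thesis by (simp add: psi_def)
qed

lemma psi_mono: "0 \<le> s \<Longrightarrow> s \<le> t \<Longrightarrow> t < 1 \<Longrightarrow> psi s \<le> psi t"
  using psi_strict_mono[of s t] by (cases "s = t") auto

text \<open>Compare the denominators \<open>2 - l\<close> and \<open>1 - l\<close>. The strictness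
  excludes equality in the eigenvalue bound when at most one edge is cheap.\<close>

lemma psi_half:
  assumes "0 < l" "l < 1"
  shows "2 * psi (l / 2) < psi l"
proof -
  have "2 * psi (l / 2) = l\<^sup>2 / (2 - l)" using assms by (simp add: psi_def field_simps power2_eq_square)
  also have "\<dots> < l\<^sup>2 / (1 - l)" using assms by (intro divide_strict_left_mono) auto
  finally show ?thesis by (simp add: psi_def)
qed

text \<open>The last summand is a nonnegative remainder: this is the tangent line inequality with its equality case.\<close>

lemma psi_tangent:
  assumes "s < 1" "c < 1"
  shows "psi s = psi c + (1 / (1 - c)\<^sup>2 - 1) * (s - c) + (s - c)\<^sup>2 / ((1 - s) * (1 - c)\<^sup>2)"
proof -
  have "1 - s \<noteq> 0" "1 - c \<noteq> 0" using assms by auto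
  then have "1 / (1 - s) = 1 / (1 - c) + (s - c) / (1 - c)\<^sup>2 + (s - c)\<^sup>2 / ((1 - s) * (1 - c)\<^sup>2)"
    by (simp add: divide_simps power2_eq_square) (simp add: algebra_simps)
  then show ?thesis using assms by (simp add: psi_alt algebra_simps)
qed

text \<open>Add the tangent inequalities at \<open>l / 2\<close>. The tangent slope is positive, so
  \<open>s + t\<close> exceeding \<open>l\<close> only helps, and at equality both quadratic
  remainders vanish.\<close>

lemma psi_pair:
  assumes "s < 1" "t < 1" "0 < l" "l < 1" "l \<le> s + t"
  shows "2 * psi (l / 2) \<le> psi s + psi t"
    and "psi s + psi t = 2 * psi (l / 2) \<Longrightarrow> s = l / 2 \<and> t = l / 2"
proof -
  define c where "c = l / 2"
  have c: "0 < c" "c < 1" using assms by (auto simp: c_def)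
  define q where "q = (\<lambda>u. (u - c)\<^sup>2 / ((1 - u) * (1 - c)\<^sup>2))"
  define m where "m = 1 / (1 - c)\<^sup>2 - 1"
  have "(1 - c)\<^sup>2 < 1" using c by (simp add: power_less_one_iff)
  then have m: "0 < m" using c by (simp add: m_def)
  have q0: "0 \<le> q s" "0 \<le> q t" using assms by (auto simp: q_def)
  have eq: "psi s + psi t = 2 * psi c + m * (s + t - l) + q s + q t"
  proof -
    have "m * (s - c) + m * (t - c) = m * (s + t - l)" by (simp add: c_def algebra_simps)
    then show ?thesis
      using psi_tangent[of s c] psi_tangent[of t c] assms c by (simp add: q_def m_def)
  qed
  have m0: "0 \<le> m * (s + t - l)" using m assms by simp
  show "2 * psi (l / 2) \<le> psi s + psi t" using eq m0 q0 by (simp add: c_def)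
  assume "psi s + psi t = 2 * psi (l / 2)"
  then have "q s = 0" "q t = 0" using eq m0 q0 by (auto simp: c_def)
  then show "s = l / 2 \<and> t = l / 2" using assms c by (auto simp: q_def c_def[symmetric])
qed

text \<open>A tree on \<open>k\<close> vertices has \<open>k - 1\<close> edges: \<open>k - 3\<close>
  of them are charged \<open>psi t\<close> and the two cheap ones \<open>psi (t / 2)\<close>
  each.\<close>

definition bound_fun :: "nat \<Rightarrow> real \<Rightarrow> real" where
  "bound_fun k t = t * k + (real k - 3) * psi t + 2 * psi (t / 2)"

lemma bound_fun_strict_mono:
  assumes "3 \<le> k" "0 \<le> s" "s < t" "t < 1"
  shows "bound_fun k s < bound_fun k t"
proof -
  have "s * k < t * k" using assms by simp
  moreover have "(real k - 3) * psi s \<le> (real k - 3) * psi t"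
    using assms psi_mono[of s t] by (intro mult_left_mono) auto
  moreover have "psi (s / 2) \<le> psi (t / 2)" using assms by (intro psi_mono) auto
  ultimately show ?thesis by (simp add: bound_fun_def)
qed

lemma bound_fun_root:
  assumes "3 \<le> k"
  obtains mu where "0 < mu" "mu < 1" "bound_fun k mu = 2"
proof -
  \<comment> \<open>At \<open>2 / k\<close> the linear term alone is 2, and this point stays below
    the pole of \<open>psi\<close> at 1.\<close>
  define b where "b = 2 / real k"
  have b: "0 < b" "b < 1" "b * k = 2" using assms by (auto simp: b_def)
  have cont: "continuous_on {0..b} (bound_fun k)"
    using b unfolding bound_fun_def psi_def by (intro continuous_intros) auto
  have "0 \<le> (real k - 3) * psi b" "0 \<le> psi (b / 2)"
    using b assms by (auto intro!: psi_nonneg mult_nonneg_nonneg)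
  then have "2 \<le> bound_fun k b" using assms by (simp add: bound_fun_def b)
  moreover have z: "bound_fun k 0 = 0" by (simp add: bound_fun_def psi_def)
  ultimately obtain mu where mu: "0 \<le> mu" "mu \<le> b" "bound_fun k mu = 2"
    using IVT'[of "bound_fun k" 0 2 b] b cont by auto
  moreover have "mu \<noteq> 0" using mu(3) z by auto
  ultimately show thesis using that[of mu] b by auto
qed

section \<open>Ground states of trees with an integer potential\<close>

locale ground_state = bridge_graph V A for V :: "'v set" and A +
  fixes v :: "'v \<Rightarrow> int" and f :: "'v \<Rightarrow> real" and l :: real
  assumes card_ge: "5 \<le> card V" and total: "sum v V = 2" and l_pos: "0 < l"
    and f_pos: "x \<in> V \<Longrightarrow> 0 < f x"
    and eigen: "x \<in> V \<Longrightarrow> real_of_int (v x) * f x + (\<Sum>y \<in> A `` {x}. f x - f y) = l * f x"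
begin

text \<open>Positive exactly when \<open>f\<close> increases from \<open>x\<close> to
  \<open>y\<close>. After division of the eigenvalue equation by \<open>f x\<close>, the neighbour
  \<open>y\<close> contributes \<open>s y x\<close>.\<close>

definition s :: "'v \<Rightarrow> 'v \<Rightarrow> real" where
  "s x y = 1 - f x / f y"

definition cost :: "'v \<times> 'v \<Rightarrow> real" where
  "cost e = psi (s (fst e) (snd e))"

lemma s_less_1: "x \<in> V \<Longrightarrow> y \<in> V \<Longrightarrow> s x y < 1"
  using f_pos by (simp add: s_def)

lemma cost_eq: "x \<in> V \<Longrightarrow> y \<in> V \<Longrightarrow> cost (x, y) = - (s x y + s y x)"
  using f_pos[of x] f_pos[of y] s_less_1[of x y]
  by (simp add: cost_def psi_alt) (simp add: s_def)

lemma cost_swap: "x \<in> V \<Longrightarrow> y \<in> V \<Longrightarrow> cost (y, x) = cost (x, y)"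
  by (simp add: cost_eq)

lemma cost_nonneg: "e \<in> A \<Longrightarrow> 0 \<le> cost e"
  using sub s_less_1 by (auto simp: cost_def intro!: psi_nonneg)

lemma vertex_eq:
  assumes "x \<in> V"
  shows "real_of_int (v x) = l - (\<Sum>y \<in> A `` {x}. s y x)"
proof -
  have "real_of_int (v x) * f x = l * f x - (\<Sum>y \<in> A `` {x}. f x * s y x)"
    using eigen[OF assms] f_pos[OF assms] by (simp add: s_def algebra_simps)
  also have "\<dots> = (l - (\<Sum>y \<in> A `` {x}. s y x)) * f x"
    by (simp add: sum_distrib_left algebra_simps)
  finally show ?thesis using f_pos[OF assms] by simp
qed

text \<open>Sum \<open>vertex_eq\<close> over \<open>S\<close>. An inner edge contributes through
  both of its arcs, and the two terms add up to minus its cost; the sum of costs runs over arcs and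
  is therefore halved.\<close>

lemma balance:
  assumes "S \<subseteq> V"
  shows "real_of_int (sum v S) = l * card S + (\<Sum>e \<in> A \<inter> S \<times> S. cost e) / 2
           - (\<Sum>(z, y) \<in> A \<inter> S \<times> (V - S). s y z)"
proof -
  have finS: "finite S" using assms fin finite_subset by blast
  have "real_of_int (sum v S) = (\<Sum>z \<in> S. l - (\<Sum>y \<in> A `` {z}. s y z))"
    using vertex_eq assms by (simp add: subset_iff)
  also have "\<dots> = l * card S - (\<Sum>z \<in> S. \<Sum>y \<in> A `` {z}. s y z)"
    by (simp add: sum_subtractf)
  also have "(\<Sum>z \<in> S. \<Sum>y \<in> A `` {z}. s y z) = (\<Sum>(z, y) \<in> (SIGMA z:S. A `` {z}). s y z)"
    using finS fin_A by (intro sum.Sigma) auto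
  also have "(SIGMA z:S. A `` {z}) = A \<inter> S \<times> S \<union> A \<inter> S \<times> (V - S)"
    using sub by auto
  also have "(\<Sum>(z, y) \<in> \<dots>. s y z)
      = (\<Sum>(z, y) \<in> A \<inter> S \<times> S. s y z) + (\<Sum>(z, y) \<in> A \<inter> S \<times> (V - S). s y z)"
    using fin_A by (intro sum.union_disjoint) auto
  also have "(\<Sum>(z, y) \<in> A \<inter> S \<times> S. s y z) = - (\<Sum>e \<in> A \<inter> S \<times> S. cost e) / 2"
  proof -
    have "(\<Sum>(z, y) \<in> A \<inter> S \<times> S. s y z) = (\<Sum>(z, y) \<in> A \<inter> S \<times> S. s z y)"
      by (rule sum.reindex_bij_witness[of _ prod.swap prod.swap]) (auto simp: sym)
    moreover have "(\<Sum>e \<in> A \<inter> S \<times> S. cost e) = (\<Sum>(z, y) \<in> A \<inter> S \<times> S. - (s z y + s y z))"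
      using arcD by (intro sum.cong) (auto simp: cost_eq)
    ultimately show ?thesis by (simp add: case_prod_unfold sum.distrib sum_negf sum_subtractf)
  qed
  finally show ?thesis by simp
qed

section \<open>Cutting off sides and comparing masses\<close>

definition mass :: "'v \<Rightarrow> 'v \<Rightarrow> int" where
  "mass x y = sum v (side x y)"

text \<open>This is \<open>balance\<close> for the middle part \<open>M\<close> left after removing
  disjoint sides. Assumption \<open>norev\<close> prevents an edge from being cut from both ends,
  which would remove its head from \<open>M\<close>.\<close>

lemma cut:
  assumes P: "P \<subseteq> A" and M: "M = V - (\<Union>(x, y) \<in> P. side x y)"
    and disj: "\<And>x y p q. (x, y) \<in> P \<Longrightarrow> (p, q) \<in> P \<Longrightarrow> (x, y) \<noteq> (p, q) \<Longrightarrow> side x y \<inter> side p q = {}"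
    and norev: "\<And>x y. (x, y) \<in> P \<Longrightarrow> (y, x) \<notin> P"
  shows "real_of_int (2 - (\<Sum>(x, y) \<in> P. mass x y))
           = l * card M + (\<Sum>e \<in> A \<inter> M \<times> M. cost e) / 2 - (\<Sum>(x, y) \<in> P. s x y)"
    and "(x, y) \<in> P \<Longrightarrow> y \<in> M"
proof -
  have finP: "finite P" using P fin_A finite_subset by blast
  have inM: "y \<in> M" if "(x, y) \<in> P" for x y
  proof -
    have "y \<notin> side p q" if "(p, q) \<in> P" for p q
    proof (cases "(p, q) = (x, y)")
      case True then show ?thesis using side_other P \<open>(x, y) \<in> P\<close> by auto
    next
      case False
      have "(p, q) \<noteq> (y, x)" using norev that \<open>(x, y) \<in> P\<close> by blast
      then show ?thesis
        using disjoint_heads[of x y p q] disj[of x y p q] False that P \<open>(x, y) \<in> P\<close> by blast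
    qed
    then show ?thesis using that P sub M by auto
  qed
  then show "(x, y) \<in> P \<Longrightarrow> y \<in> M" .
  \<comment> \<open>The arcs leaving \<open>M\<close> are the reversed cut arcs, since a side can
    only be entered through its own edge.\<close>
  have sw: "A \<inter> M \<times> (V - M) = prod.swap ` P"
  proof (intro equalityI subsetI)
    fix e assume "e \<in> A \<inter> M \<times> (V - M)"
    then obtain z w where e: "e = (z, w)" "(z, w) \<in> A" "z \<in> M" "w \<in> V" "w \<notin> M" by auto
    then obtain x y where xy: "(x, y) \<in> P" "w \<in> side x y" using M by auto
    then have "z \<notin> side x y" using e M by auto
    then have "(w, z) = (x, y)" using side_step[of x y w z] xy P e sym by auto
    then show "e \<in> prod.swap ` P" using xy e by force
  next
    fix e assume "e \<in> prod.swap ` P"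
    then obtain x y where e: "e = (y, x)" "(x, y) \<in> P" by auto
    moreover have "(x, y) \<in> A" using e P by blast
    moreover have "x \<notin> M" using M e(2) side_self by auto
    ultimately show "e \<in> A \<inter> M \<times> (V - M)"
      using inM[of x y] sym[of x y] arcD(1)[of x y] by simp
  qed
  have "(\<Sum>(z, y) \<in> A \<inter> M \<times> (V - M). s y z) = (\<Sum>(x, y) \<in> P. s x y)"
    unfolding sw by (subst sum.reindex) (auto simp: case_prod_unfold)
  moreover have "sum v M = 2 - (\<Sum>(x, y) \<in> P. mass x y)"
  proof -
    define D where "D = (\<lambda>e. side (fst e) (snd e))"
    have DV: "D e \<subseteq> V" if "e \<in> P" for e
      using that P arcD(1)[of "fst e" "snd e"] side_sub by (auto simp: D_def)
    have M': "M = V - (\<Union>e \<in> P. D e)" by (simp add: M D_def case_prod_unfold)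
    have "(\<Union>e \<in> P. D e) \<subseteq> V" using DV by (rule UN_least)
    then have "sum v M = 2 - sum v (\<Union>e \<in> P. D e)"
      unfolding M' using sum_diff[of V "\<Union>e \<in> P. D e" v] fin total by simp
    also have "sum v (\<Union>e \<in> P. D e) = (\<Sum>e \<in> P. sum v (D e))"
    proof (rule sum.UNION_disjoint[OF finP])
      show "\<forall>e \<in> P. finite (D e)" using DV fin finite_subset by metis
      show "\<forall>e \<in> P. \<forall>e' \<in> P. e \<noteq> e' \<longrightarrow> D e \<inter> D e' = {}"
      proof (intro ballI impI)
        fix e e' assume "e \<in> P" "e' \<in> P" "e \<noteq> e'"
        then show "D e \<inter> D e' = {}"
          using disj[of "fst e" "snd e" "fst e'" "snd e'"] by (simp add: D_def)
      qed
    qed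
    finally show ?thesis by (simp add: mass_def D_def case_prod_unfold)
  qed
  ultimately show "real_of_int (2 - (\<Sum>(x, y) \<in> P. mass x y))
           = l * card M + (\<Sum>e \<in> A \<inter> M \<times> M. cost e) / 2 - (\<Sum>(x, y) \<in> P. s x y)"
    using balance[of M] M by auto
qed

lemma mass_rev: "(x, y) \<in> A \<Longrightarrow> mass y x = 2 - mass x y"
  unfolding mass_def using side_rev[of x y] side_sub[of x y] arcD[of x y] fin total
  by (simp add: sum_diff)

lemma costs_nonneg: "B \<subseteq> A \<Longrightarrow> 0 \<le> (\<Sum>e \<in> B. cost e)"
  using cost_nonneg by (intro sum_nonneg) auto

lemma total_cost: "2 = l * card V + (\<Sum>e \<in> A. cost e) / 2"
proof -
  have "A \<inter> V \<times> V = A" using sub by auto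
  then show ?thesis using balance[of V] total by simp
qed

lemma l_less: "l * card V \<le> 2" "l < 1 / 2"
proof -
  show "l * card V \<le> 2" using total_cost costs_nonneg[of A] by simp
  then show "l < 1 / 2"
    using card_ge l_pos mult_left_mono[of 5 "real (card V)" l] by linarith
qed

text \<open>Cut off the opposite side only, so that the middle part is \<open>side x y\<close>, and
  discard the inner costs.\<close>

lemma mass_le:
  assumes "(x, y) \<in> A"
  shows "l * card (side x y) - s y x \<le> mass x y"
proof -
  have "V - side y x = side x y" using side_rev[OF sym[OF assms]] by simp
  then have "real_of_int (2 - mass y x) = l * card (side x y)
      + (\<Sum>e \<in> A \<inter> side x y \<times> side x y. cost e) / 2 - s y x"
    using cut(1)[of "{(y, x)}" "side x y"] sym assms irrefl[OF assms] by auto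
  then show ?thesis using mass_rev[OF assms] costs_nonneg[of "A \<inter> side x y \<times> side x y"] by auto
qed

section \<open>Edges cheaper than \<open>psi l\<close>\<close>

lemma cost_ge: "x \<in> V \<Longrightarrow> y \<in> V \<Longrightarrow> l \<le> s x y \<Longrightarrow> psi l \<le> cost (x, y)"
  unfolding cost_def using psi_mono[of l "s x y"] s_less_1 l_pos by auto

lemma cost_gr: "x \<in> V \<Longrightarrow> y \<in> V \<Longrightarrow> l < s x y \<Longrightarrow> psi l < cost (x, y)"
  unfolding cost_def using psi_strict_mono[of l "s x y"] s_less_1 l_pos by auto

lemma s_ge:
  assumes "(x, y) \<in> A" "mass x y \<le> 0"
  shows "l * card (side x y) \<le> s y x"
proof -
  have "real_of_int (mass x y) \<le> 0" using assms by simp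
  then show ?thesis using mass_le[OF assms(1)] by linarith
qed

lemma card_side: "(x, y) \<in> A \<Longrightarrow> 1 \<le> card (side x y)"
  using fin_side[of x y] side_self[of x y] arcD[of x y] by (auto simp: Suc_le_eq card_gt_0_iff)

text \<open>A side of mass at most 0 forces a value of \<open>s\<close> of at least \<open>l\<close>
  on its edge, hence cost at least \<open>psi l\<close>. So both sides of a cheap edge have positive
  integer mass, and the masses add up to 2.\<close>

lemma cheap_mass:
  assumes "(x, y) \<in> A" "cost (x, y) < psi l"
  shows "mass x y = 1"
proof -
  have *: "0 < mass p q" if "(p, q) \<in> A" "cost (p, q) < psi l" for p q
  proof (rule ccontr)
    assume "\<not> 0 < mass p q"
    then have "l * card (side p q) \<le> s q p" using s_ge[OF that(1)] by simp
    moreover have "l * 1 \<le> l * card (side p q)"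
      using card_side[OF that(1)] l_pos by (intro mult_left_mono) auto
    ultimately have "psi l \<le> cost (q, p)" using cost_ge that arcD by auto
    then show False using that cost_swap arcD by force
  qed
  have "0 < mass x y" "0 < mass y x"
    using *[of x y] *[of y x] assms sym cost_swap[of y x] arcD by auto
  then show ?thesis using mass_rev[OF assms(1)] by simp
qed

lemma cheap_s:
  assumes "(x, y) \<in> A" "cost (x, y) < psi l"
  shows "s x y < l"
  using cost_ge[of x y] assms arcD by force

text \<open>The two sides already carry the whole mass 2, so the left-hand side of
  \<open>cut\<close> is 0.\<close>

lemma pair_eq:
  assumes "(x, y) \<in> A" "(p, q) \<in> A" "side x y \<inter> side p q = {}" "(p, q) \<noteq> (y, x)"
    and "mass x y = 1" "mass p q = 1" and M: "M = V - side x y - side p q"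
  shows "s x y + s p q = l * card M + (\<Sum>e \<in> A \<inter> M \<times> M. cost e) / 2" "y \<in> M" "q \<in> M"
proof -
  have ne: "(x, y) \<noteq> (p, q)" using assms(3) side_self by auto
  have M': "M = V - (\<Union>(x, y) \<in> {(x, y), (p, q)}. side x y)" using M by auto
  have d: "side a b \<inter> side c d = {}" if "(a, b) \<in> {(x, y), (p, q)}" "(c, d) \<in> {(x, y), (p, q)}"
    "(a, b) \<noteq> (c, d)" for a b c d using that assms(3) by auto
  have n: "(b, a) \<notin> {(x, y), (p, q)}" if "(a, b) \<in> {(x, y), (p, q)}" for a b
    using that assms(4) irrefl assms(1,2) by auto
  note c = cut[of "{(x, y), (p, q)}" M, OF _ M' d n]
  show "s x y + s p q = l * card M + (\<Sum>e \<in> A \<inter> M \<times> M. cost e) / 2"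
    using c(1) assms(1,2,5,6) ne by simp
  show "y \<in> M" "q \<in> M" using c(2)[of x y] c(2)[of p q] assms(1,2) by auto
qed

lemma pair_ge:
  assumes "(x, y) \<in> A" "(p, q) \<in> A" "side x y \<inter> side p q = {}" "(p, q) \<noteq> (y, x)"
    and "mass x y = 1" "mass p q = 1" and "N \<subseteq> V - side x y - side p q"
  shows "l * card N \<le> s x y + s p q"
proof -
  define M where "M = V - side x y - side p q"
  have "card N \<le> card M" using assms(7) fin by (auto simp: M_def intro: card_mono)
  then have "l * card N \<le> l * card M" using l_pos by simp
  then show ?thesis using pair_eq[OF assms(1-6) M_def] costs_nonneg[of "A \<inter> M \<times> M"] by simp
qed

text \<open>The middle part contains \<open>y\<close>, so the two values of \<open>s\<close> add up
  to at least \<open>l\<close>. Each is less than \<open>l\<close> because the edges are cheap, so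
  both are positive: \<open>f\<close> increases along both arcs towards the middle.\<close>

lemma cheap_pair_pos:
  assumes "(x, y) \<in> A" "(p, q) \<in> A" "side x y \<inter> side p q = {}" "(p, q) \<noteq> (y, x)"
    and "cost (x, y) < psi l" "cost (p, q) < psi l"
  shows "0 < s x y" "0 < s p q" "l \<le> s x y + s p q"
proof -
  have m: "mass x y = 1" "mass p q = 1" using cheap_mass assms by auto
  have "{y} \<subseteq> V - side x y - side p q"
    using pair_eq(2)[OF assms(1-4) m refl] by simp
  from pair_ge[OF assms(1-4) m this] show "l \<le> s x y + s p q" by simp
  then show "0 < s x y" "0 < s p q" using cheap_s[of x y] cheap_s[of p q] assms by auto
qed

lemma s_pos_iff: "x \<in> V \<Longrightarrow> y \<in> V \<Longrightarrow> 0 < s x y \<longleftrightarrow> f x < f y"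
  using f_pos by (simp add: s_def)

text \<open>
  Orient three cheap edges towards the larger value of \<open>f\<close>. Their sides are then disjoint and have mass 1,
  so the rest of the tree has mass -1, which is impossible for \<open>l < 1 / 2\<close>.
\<close>

lemma no_third_cheap:
  assumes "(x, y) \<in> A" "(p, q) \<in> A" "side x y \<inter> side p q = {}" "(p, q) \<noteq> (y, x)"
    and "cost (x, y) < psi l" "cost (p, q) < psi l"
    and "e \<in> A" "cost e < psi l"
  shows "e \<in> {(x, y), (y, x), (p, q), (q, p)}"
proof (rule ccontr)
  assume ne: "e \<notin> {(x, y), (y, x), (p, q), (q, p)}"
  obtain u w where e: "e = (u, w)" by (cases e)
  then have uw: "(u, w) \<in> A" "cost (u, w) < psi l" using assms by auto
  \<comment> \<open>Of the two values \<open>s a b\<close> and \<open>s b a\<close> at most one is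
    positive. Two cheap arcs pointing at each other have positive \<open>s\<close>, so an arc
    already known to have positive \<open>s\<close> is not reversed by this choice.\<close>
  have orient: "\<exists>u' w'. ((u', w') = (u, w) \<or> (u', w') = (w, u)) \<and> side a b \<inter> side u' w' = {} \<and> 0 < s u' w'"
    if ab: "(a, b) \<in> A" "cost (a, b) < psi l" "0 < s a b" "(u, w) \<noteq> (a, b)" "(u, w) \<noteq> (b, a)" for a b
  proof -
    obtain a' b' u' w' where o: "(a', b') = (a, b) \<or> (a', b') = (b, a)"
      "(u', w') = (u, w) \<or> (u', w') = (w, u)" "side a' b' \<inter> side u' w' = {}"
      using disjoint_orientation[OF ab(1) uw(1) ab(4,5)] by blast
    have A': "(a', b') \<in> A" "(u', w') \<in> A" using o ab uw sym by auto
    have c': "cost (a', b') < psi l" "cost (u', w') < psi l"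
      using o ab(1,2) uw cost_swap[of a b] cost_swap[of u w] arcD by auto
    have "(u', w') \<noteq> (b', a')" using o ab(4,5) by auto
    from cheap_pair_pos[OF A' o(3) this c'] have pos: "0 < s a' b'" "0 < s u' w'" by auto
    then have "(a', b') = (a, b)" using o(1) ab(1,3) s_pos_iff arcD by fastforce
    then show ?thesis using o pos by blast
  qed
  note sp = cheap_pair_pos[OF assms(1-6)]
  obtain u1 w1 where o1: "(u1, w1) = (u, w) \<or> (u1, w1) = (w, u)" "side x y \<inter> side u1 w1 = {}" "0 < s u1 w1"
    using orient[of x y] assms sp ne e by auto
  obtain u2 w2 where o2: "(u2, w2) = (u, w) \<or> (u2, w2) = (w, u)" "side p q \<inter> side u2 w2 = {}" "0 < s u2 w2"
    using orient[of p q] assms sp ne e by auto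
  \<comment> \<open>The third edge received an orientation twice, once relative to each of the
    others; positivity of \<open>s\<close> makes the two agree.\<close>
  have "(u2, w2) = (u1, w1)" using o1 o2 uw(1) s_pos_iff arcD by fastforce
  with o2 have d: "side p q \<inter> side u1 w1 = {}" by simp
  have A1: "(u1, w1) \<in> A" using o1 uw sym by auto
  have c1: "cost (u1, w1) < psi l" using o1 uw cost_swap[of u w] arcD by auto
  define P where "P = {(x, y), (p, q), (u1, w1)}"
  define M where "M = V - (\<Union>(x, y) \<in> P. side x y)"
  have dist: "(x, y) \<noteq> (p, q)" "(x, y) \<noteq> (u1, w1)" "(p, q) \<noteq> (u1, w1)"
    using assms(3) o1(2) d side_self[of p q] side_self[of u1 w1] by auto
  have PA: "P \<subseteq> A" using assms A1 by (auto simp: P_def)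
  have dj: "side a b \<inter> side a' b' = {}" if "(a, b) \<in> P" "(a', b') \<in> P" "(a, b) \<noteq> (a', b')" for a b a' b'
    using that assms(3) o1(2) d by (auto simp: P_def)
  have pos: "0 < s a b" if "(a, b) \<in> P" for a b using that sp o1(3) by (auto simp: P_def)
  have nr: "(b, a) \<notin> P" if "(a, b) \<in> P" for a b
    using pos[OF that] pos[of b a] s_pos_iff[of a b] s_pos_iff[of b a] PA that arcD by fastforce
  note c = cut[OF PA M_def dj nr]
  have "y \<in> M" using c(2)[of x y] by (simp add: P_def)
  then have "1 \<le> card M" using fin by (auto simp: M_def Suc_le_eq card_gt_0_iff)
  then have "l * 1 \<le> l * card M" using l_pos by (intro mult_left_mono) auto
  moreover have "(\<Sum>(x, y) \<in> P. mass x y) = 3"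
    using cheap_mass[OF assms(1,5)] cheap_mass[OF assms(2,6)] cheap_mass[OF A1 c1] dist
    by (simp add: P_def)
  moreover have "(\<Sum>(x, y) \<in> P. s x y) < 3 * l"
    using cheap_s[OF assms(1,5)] cheap_s[OF assms(2,6)] cheap_s[OF A1 c1] dist by (simp add: P_def)
  moreover have "0 \<le> (\<Sum>e \<in> A \<inter> M \<times> M. cost e)" by (rule costs_nonneg) auto
  \<comment> \<open>The left-hand side of \<open>cut\<close> is -1, while the right-hand side
    exceeds \<open>l - 3 * l\<close>, which is greater than -1.\<close>
  ultimately show False using c(1) l_less by simp
qed

section \<open>The eigenvalue bound and its equality case\<close>

definition extremal_pair :: "'v \<Rightarrow> 'v \<Rightarrow> 'v \<Rightarrow> 'v \<Rightarrow> bool" where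
  "extremal_pair x y p q \<longleftrightarrow> (x, y) \<in> A \<and> (p, q) \<in> A \<and> side x y \<inter> side p q = {} \<and> (p, q) \<noteq> (y, x)
     \<and> mass x y = 1 \<and> mass p q = 1 \<and> s x y = l / 2 \<and> s p q = l / 2
     \<and> (\<forall>e \<in> A - {(x, y), (y, x), (p, q), (q, p)}. cost e = psi l)"

text \<open>If two different edges are cheap, all others cost at least \<open>psi l\<close> by
  \<open>no_third_cheap\<close>, and \<open>psi_pair\<close> handles the two. If at most one is
  cheap, its cost is dropped: the other \<open>k - 2\<close> edges cost at least
  \<open>psi l\<close> each, and \<open>psi_half\<close> makes the inequality strict.\<close>

lemma eigenvalue_dichotomy:
  "l * card V + (real (card V) - 3) * psi l + 2 * psi (l / 2) < 2 \<or>
   l * card V + (real (card V) - 3) * psi l + 2 * psi (l / 2) = 2 \<and> (\<exists>x y p q. extremal_pair x y p q)"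
proof -
  have l1: "l < 1" using l_less by simp
  have B0: "0 < psi l" using psi_half[OF l_pos l1] psi_nonneg[of "l / 2"] l1 by simp
  have cA: "2 * real (card V) - 2 \<le> card A"
  proof -
    have "2 * (card V - 1) \<le> card A" by (rule card_arcs)
    then have "real (2 * (card V - 1)) \<le> card A" by (simp only: of_nat_le_iff)
    then show ?thesis using card_ge by (simp add: of_nat_diff)
  qed
  show ?thesis
  proof (cases "\<exists>x y u w. (x, y) \<in> A \<and> (u, w) \<in> A \<and> (u, w) \<noteq> (x, y) \<and> (u, w) \<noteq> (y, x)
      \<and> cost (x, y) < psi l \<and> cost (u, w) < psi l")
    case True
    then obtain x0 y0 u w where c0: "(x0, y0) \<in> A" "(u, w) \<in> A" "(u, w) \<noteq> (x0, y0)" "(u, w) \<noteq> (y0, x0)"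
      "cost (x0, y0) < psi l" "cost (u, w) < psi l" by blast
    obtain x y p q where o: "(x, y) = (x0, y0) \<or> (x, y) = (y0, x0)"
      "(p, q) = (u, w) \<or> (p, q) = (w, u)" "side x y \<inter> side p q = {}"
      using disjoint_orientation[OF c0(1-4)] by blast
    have A': "(x, y) \<in> A" "(p, q) \<in> A" using o c0 sym by auto
    have c': "cost (x, y) < psi l" "cost (p, q) < psi l"
      using o c0 cost_swap[of x0 y0] cost_swap[of u w] arcD by auto
    have ne: "(p, q) \<noteq> (y, x)" using o(1,2) c0(3,4) by auto
    note third = no_third_cheap[OF A' o(3) ne c']
    note sp = cheap_pair_pos[OF A' o(3) ne c']
    define X where "X = {(x, y), (y, x), (p, q), (q, p)}"
    have XA: "X \<subseteq> A" using A' sym by (auto simp: X_def)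
    have xypq: "(x, y) \<noteq> (p, q)" using o(3) side_self[of x y] by auto
    have "card X = 4" using xypq ne irrefl A' by (auto simp: X_def card_insert_if)
    then have cAX: "real (card (A - X)) = real (card A) - 4"
      using XA fin_A card_mono[OF fin_A XA] by (simp add: card_Diff_subset finite_subset of_nat_diff)
    have "(\<Sum>e \<in> X. cost e) = 2 * psi (s x y) + 2 * psi (s p q)"
    proof -
      have "(\<Sum>e \<in> X. cost e) = cost (x, y) + cost (y, x) + cost (p, q) + cost (q, p)"
        using xypq ne irrefl A' by (auto simp: X_def)
      then show ?thesis using cost_swap[of x y] cost_swap[of p q] A' arcD by (auto simp: cost_def)
    qed
    then have "(\<Sum>e \<in> A. cost e) = 2 * psi (s x y) + 2 * psi (s p q) + (\<Sum>e \<in> A - X. cost e)"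
      using sum.subset_diff[OF XA fin_A, of cost] by simp
    also have "(\<Sum>e \<in> A - X. cost e) = (real (card A) - 4) * psi l + (\<Sum>e \<in> A - X. cost e - psi l)"
      using cAX by (simp add: sum_subtractf)
    finally have tot: "2 = l * card V + psi (s x y) + psi (s p q) + (real (card A) - 4) / 2 * psi l
        + (\<Sum>e \<in> A - X. cost e - psi l) / 2"
      using total_cost by (simp add: field_simps)
    have ge: "0 \<le> cost e - psi l" if "e \<in> A - X" for e
      using third[of e] that by (force simp: X_def)
    have S0: "0 \<le> (\<Sum>e \<in> A - X. cost e - psi l)" by (rule sum_nonneg) (rule ge)
    have "(real (card V) - 3) * psi l \<le> (real (card A) - 4) / 2 * psi l"
      using cA B0 by (intro mult_right_mono) auto
    moreover note pp = psi_pair[OF s_less_1[of x y] s_less_1[of p q] l_pos l1 sp(3)]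
    have p1: "2 * psi (l / 2) \<le> psi (s x y) + psi (s p q)" using pp A' arcD by auto
    ultimately have le: "l * card V + (real (card V) - 3) * psi l + 2 * psi (l / 2) \<le> 2"
      using tot S0 by simp
    show ?thesis
    proof (cases "l * card V + (real (card V) - 3) * psi l + 2 * psi (l / 2) = 2")
      case True
      \<comment> \<open>At equality, the surpluses of the number of arcs, of the cheap pair and of
        the remaining arcs over their lower bounds add up to 0. The last two are read off
        here.\<close>
      have eq: "psi (s x y) + psi (s p q) = 2 * psi (l / 2)" "(\<Sum>e \<in> A - X. cost e - psi l) = 0"
        using True tot S0 p1 \<open>(real (card V) - 3) * psi l \<le> (real (card A) - 4) / 2 * psi l\<close> by linarith+
      have "s x y = l / 2" "s p q = l / 2" using pp(2)[OF _ _ _ _ eq(1)] A' arcD by auto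
      moreover have "\<forall>e \<in> A - X. cost e = psi l"
        using eq(2) sum_nonneg_eq_0_iff[of "A - X" "\<lambda>e. cost e - psi l"] fin_A ge by auto
      ultimately have "extremal_pair x y p q"
        using A' o(3) ne cheap_mass c' by (auto simp: extremal_pair_def X_def)
      then show ?thesis using True by blast
    qed (use le in auto)
  next
    case False
    obtain Y where Y: "Y \<subseteq> A" "card Y \<le> 2" "\<forall>e \<in> A - Y. psi l \<le> cost e"
    proof (cases "\<exists>e \<in> A. cost e < psi l")
      case True
      then obtain x y where xy: "(x, y) \<in> A" "cost (x, y) < psi l" by auto
      have "\<forall>e \<in> A - {(x, y), (y, x)}. psi l \<le> cost e" using False xy by force
      moreover have "card {(x, y), (y, x)} \<le> 2" using irrefl[OF xy(1)] by simp
      ultimately show thesis using that[of "{(x, y), (y, x)}"] xy sym by auto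
    next
      case False
      then show thesis using that[of "{}"] by force
    qed
    have "real (card A) - 2 \<le> card (A - Y)"
      using Y fin_A by (simp add: card_Diff_subset finite_subset card_mono of_nat_diff)
    then have "(2 * real (card V) - 4) * psi l \<le> card (A - Y) * psi l"
      using cA B0 by (intro mult_right_mono) auto
    also have "\<dots> = (\<Sum>e \<in> A - Y. psi l)" by simp
    also have "\<dots> \<le> (\<Sum>e \<in> A - Y. cost e)" using Y by (intro sum_mono) auto
    also have "\<dots> \<le> (\<Sum>e \<in> A. cost e)" using fin_A cost_nonneg by (intro sum_mono2) auto
    finally have "l * card V + (real (card V) - 2) * psi l \<le> 2" using total_cost by (simp add: field_simps)
    then show ?thesis using psi_half[OF l_pos l1] by (simp add: algebra_simps)
  qed
qed

text \<open>The two values \<open>l / 2\<close> sum to \<open>l\<close>, so \<open>pair_eq\<close>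
  leaves room for only one vertex in the middle part, which contains both heads.\<close>

lemma extremal_pairD:
  assumes "extremal_pair x y p q"
  shows "q = y" and "V - side x y - side p y = {y}"
proof -
  have h: "(x, y) \<in> A" "(p, q) \<in> A" "side x y \<inter> side p q = {}" "(p, q) \<noteq> (y, x)"
    "mass x y = 1" "mass p q = 1" "s x y = l / 2" "s p q = l / 2"
    using assms by (auto simp: extremal_pair_def)
  define M where "M = V - side x y - side p q"
  note pe = pair_eq[OF h(1-6) M_def]
  have "0 \<le> (\<Sum>e \<in> A \<inter> M \<times> M. cost e)" by (rule costs_nonneg) auto
  then have "l * card M \<le> l * 1" using pe(1) h(7,8) by simp
  then have "card M \<le> 1" using l_pos by simp
  moreover have "finite M" using fin by (simp add: M_def)
  ultimately have "M = {y}" using pe(2) card_le_Suc0_iff_eq[of M] by auto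
  then show "q = y" using pe(3) by simp
  with \<open>M = {y}\<close> show "V - side x y - side p y = {y}" by (simp add: M_def)
qed

lemma extremal_pair_sym:
  assumes "extremal_pair x y p q" shows "extremal_pair p q x y"
proof -
  have "{(x, y), (y, x), (p, q), (q, p)} = {(p, q), (q, p), (x, y), (y, x)}" by auto
  with assms show ?thesis unfolding extremal_pair_def by (auto simp: Int_commute)
qed

text \<open>The edge to \<open>z\<close> costs exactly \<open>psi l\<close>, so neither
  \<open>s x z\<close> nor \<open>s z x\<close> exceeds \<open>l\<close>. Once the branch is known
  to have mass at most 0, \<open>s_ge\<close> leaves room for a single vertex and forces
  \<open>s x z = l\<close>.\<close>

lemma extremal_branch:
  assumes "extremal_pair x c p c" "(x, z) \<in> A" "z \<noteq> c"
  shows "side z x = {z}" "v z = 0" "s x z = l"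
proof -
  have h: "(x, c) \<in> A" "(p, c) \<in> A" "side x c \<inter> side p c = {}"
    "mass p c = 1" "s x c = l / 2" "s p c = l / 2"
    "\<forall>e \<in> A - {(x, c), (c, x), (p, c), (c, p)}. cost e = psi l"
    using assms(1) by (auto simp: extremal_pair_def)
  have zx: "(z, x) \<in> A" using assms sym by simp
  have xp: "x \<noteq> p" using h(3) side_self[of x c] by auto
  have "(x, z) \<in> A - {(x, c), (c, x), (p, c), (c, p)}" "(z, x) \<in> A - {(x, c), (c, x), (p, c), (c, p)}"
    using assms(2,3) zx xp irrefl[OF h(1)] by auto
  then have cs: "cost (x, z) = psi l" "cost (z, x) = psi l" using h(7) by blast+
  have V: "x \<in> V" "z \<in> V" "c \<in> V" using arcD assms(2) h(1) by auto
  have sle: "s x z \<le> l" "s z x \<le> l" using cost_gr[of x z] cost_gr[of z x] cs V by force+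
  have x_out: "x \<notin> side z x" by (rule side_other[OF zx])
  have c_out: "c \<notin> side z x"
    using side_step[OF zx _ sym[OF h(1)]] x_out assms(3) by auto
  have "z \<in> side x c" using side_step[OF h(1) side_self assms(2)] assms(3) by auto
  then have "side z x \<subseteq> side x c"
    by (rule side_mono[OF zx sym[OF h(1)]]) (rule side_self)
  then have dj: "side z x \<inter> side p c = {}" using h(3) by auto
  have two: "card {x, c} = 2" using irrefl[OF h(1)] by simp
  have "mass z x < 1"
  proof (rule ccontr)
    assume "\<not> mass z x < 1"
    then consider "mass z x = 1" | "mass x z \<le> 0" using mass_rev[OF zx] by linarith
    then show False
    proof cases
      case 1
      \<comment> \<open>With mass 1 behind both \<open>(z, x)\<close> and \<open>(p, c)\<close>, the
        middle part has at least two vertices, but \<open>s z x + s p c\<close> is at most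
        \<open>3 * l / 2\<close>.\<close>
      have "{x, c} \<subseteq> V - side z x - side p c"
        using V x_out c_out side_other[OF h(2)] side_self[of x c] h(3) by auto
      moreover have "(p, c) \<noteq> (x, z)" using xp by simp
      ultimately have "l * card {x, c} \<le> s z x + s p c"
        using pair_ge[OF zx h(2) dj _ 1 h(4)] by blast
      then show False using two sle h(6) l_pos by simp
    next
      case 2
      \<comment> \<open>Here a side of nonpositive mass has at least two vertices, so
        \<open>s z x\<close> would be at least \<open>2 * l\<close>.\<close>
      have "{x, c} \<subseteq> side x z" using V x_out c_out side_rev[OF zx] by auto
      then have "card {x, c} \<le> card (side x z)" using V fin_side by (intro card_mono) auto
      then have "l * 2 \<le> l * card (side x z)" using two l_pos by (intro mult_left_mono) auto
      then show False using s_ge[OF assms(2) 2] sle l_pos by linarith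
    qed
  qed
  then have ge: "l * card (side z x) \<le> s x z" using s_ge[OF zx] by simp
  also have "\<dots> \<le> l * 1" using sle by simp
  finally have "card (side z x) \<le> 1" using l_pos by simp
  then show side: "side z x = {z}"
    using card_le_Suc0_iff_eq[of "side z x"] fin_side[OF V(2)] side_self[of z x] by auto
  then show eq: "s x z = l" using ge sle by simp
  have "0 \<le> mass z x" using mass_le[OF zx] side eq by simp
  then show "v z = 0" using \<open>mass z x < 1\<close> side by (simp add: mass_def)
qed

text \<open>All branches at \<open>x\<close> other than the one through \<open>c\<close> are single
  vertices of mass 0. The last identity is \<open>vertex_eq\<close> at \<open>x\<close>; its
  right-hand side depends on \<open>l\<close> alone, so the two sides of the pair have equally many
  vertices.\<close>

lemma extremal_side:
  assumes "extremal_pair x c p c"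
  defines "L \<equiv> A `` {x} - {c}"
  shows "side x c = insert x L" "v x = 1" "\<And>z. z \<in> L \<Longrightarrow> A `` {z} = {x}"
    "card L * (l / (1 - l)) = 2 - l - 1 / (1 - l / 2)"
proof -
  have h: "(x, c) \<in> A" "mass x c = 1" "s x c = l / 2"
    using assms(1) by (auto simp: extremal_pair_def)
  have xV: "x \<in> V" "c \<in> V" using arcD h by auto
  note br = extremal_branch[OF assms(1)]
  show side: "side x c = insert x L"
  proof (intro equalityI subsetI)
    fix z assume z: "z \<in> side x c"
    show "z \<in> insert x L"
    proof (cases "z = x")
      case False
      have "z \<in> V" using z side_sub xV by auto
      then obtain w where w: "(x, w) \<in> A" "z \<in> side w x" using in_branch[of x z] xV False by auto
      then have "w \<noteq> c" using side_disjoint[OF h(1)] z by auto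
      then show ?thesis using br(1)[of w] w by (auto simp: L_def)
    qed simp
  next
    fix z assume "z \<in> insert x L"
    then show "z \<in> side x c"
      using side_self side_step[OF h(1) side_self, of z] by (auto simp: L_def)
  qed
  have finL: "finite L" using fin_A by (simp add: L_def finite_Image)
  have xL: "x \<notin> L" using irrefl by (auto simp: L_def)
  have "sum v L = 0" using br(2) by (intro sum.neutral) (auto simp: L_def)
  then show vx: "v x = 1" using h(2) side finL xL by (simp add: mass_def)
  show "A `` {z} = {x}" if "z \<in> L" for z
  proof -
    have xz: "(x, z) \<in> A" "z \<noteq> c" using that by (auto simp: L_def)
    have "w = x" if "(z, w) \<in> A" for w
      using side_step[OF sym[OF xz(1)] side_self that] br(1)[OF xz] irrefl[OF that] by auto
    then show ?thesis using sym[OF xz(1)] by blast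
  qed
  have l1: "l < 1" using l_less by simp
  have s': "s b a = 1 - 1 / (1 - s a b)" if "a \<in> V" "b \<in> V" for a b
    using f_pos[OF that(1)] f_pos[OF that(2)] by (simp add: s_def)
  have "s z x = - (l / (1 - l))" if "z \<in> L" for z
    using s'[of x z] br(3)[of z] that xV arcD l1 by (auto simp: L_def field_simps)
  then have sL: "(\<Sum>z \<in> L. s z x) = - (card L * (l / (1 - l)))" by simp
  have "A `` {x} = insert c L" "c \<notin> L" using h(1) by (auto simp: L_def)
  then have "1 = l - s c x + card L * (l / (1 - l))"
    using vertex_eq[OF xV(1)] vx sL finL by simp
  then show "card L * (l / (1 - l)) = 2 - l - 1 / (1 - l / 2)"
    using s'[OF xV] h(3) by simp
qed

theorem extremal_structure:
  assumes "extremal_pair x0 y0 p0 q0"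
  obtains c x p L L' where
    "distinct [c, x, p]" "finite L" "finite L'" "L \<inter> L' = {}"
    "{c, x, p} \<inter> (L \<union> L') = {}" "V = {c, x, p} \<union> L \<union> L'"
    "A = ({(c, x), (c, p)} \<union> {x} \<times> L \<union> {p} \<times> L') \<union> ({(c, x), (c, p)} \<union> {x} \<times> L \<union> {p} \<times> L')\<inverse>"
    "card L = card L'" "v c = 0" "v x = 1" "v p = 1" "\<forall>z \<in> L \<union> L'. v z = 0"
proof -
  define c x p where "c = y0" "x = x0" "p = p0"
  have e: "extremal_pair x c p c" using assms extremal_pairD(1)[OF assms] by (simp add: c_x_p_def)
  note e' = extremal_pair_sym[OF e]
  have h: "(x, c) \<in> A" "(p, c) \<in> A" "side x c \<inter> side p c = {}" "mass x c = 1" "mass p c = 1"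
    using e by (auto simp: extremal_pair_def)
  define L L' where "L = A `` {x} - {c}" "L' = A `` {p} - {c}"
  note S = extremal_side[OF e, folded L_L'_def] and S' = extremal_side[OF e', folded L_L'_def]
  have fL: "finite L" "finite L'" using fin_A by (simp_all add: L_L'_def finite_Image)
  have co: "c \<notin> side x c" "c \<notin> side p c" using side_other h by auto
  have dis: "distinct [c, x, p]" "L \<inter> L' = {}" "{c, x, p} \<inter> (L \<union> L') = {}"
    using h(3) co S(1) S'(1) irrefl by (auto simp: L_L'_def)
  have V: "V = insert c (side x c \<union> side p c)"
    using extremal_pairD(2)[OF e] side_sub[of x c] side_sub[of p c] arcD h(1,2) by auto
  have fs: "finite (side x c)" "finite (side p c)" using S(1) S'(1) fL by auto
  \<comment> \<open>Both sides have mass 1, so nothing of the total 2 is left for the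
    centre.\<close>
  have "sum v V = v c + (mass x c + mass p c)"
    unfolding V mass_def using fs co h(3) by (simp add: sum.union_disjoint)
  then have vc: "v c = 0" using total h(4,5) by simp
  have V': "V = {c, x, p} \<union> L \<union> L'" using V S(1) S'(1) by auto
  let ?E = "{(c, x), (c, p)} \<union> {x} \<times> L \<union> {p} \<times> L'"
  have "A = ?E \<union> ?E\<inverse>"
  proof (intro equalityI subsetI)
    fix e assume "e \<in> A"
    then obtain a b where ab: "e = (a, b)" "(a, b) \<in> A" by (cases e) auto
    have nbr_c: "w = x \<or> w = p" if "(w, c) \<in> A" for w
    proof -
      have "w \<in> side x c \<or> w \<in> side p c" using V arcD that irrefl[OF that] by auto
      then show ?thesis
        using side_step[OF h(1) _ that] side_step[OF h(2) _ that] co by auto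
    qed
    have "a \<in> V" using ab arcD by auto
    then consider "a = c" | "a = x" | "a = p" | "a \<in> L" | "a \<in> L'" using V' by auto
    then show "e \<in> ?E \<union> ?E\<inverse>"
    proof cases
      case 1 then show ?thesis using nbr_c[of b] sym ab by auto
    next
      case 2 then show ?thesis using ab by (auto simp: L_L'_def)
    next
      case 3 then show ?thesis using ab by (auto simp: L_L'_def)
    next
      case 4 then show ?thesis using S(3)[OF 4] ab by auto
    next
      case 5 then show ?thesis using S'(3)[OF 5] ab by auto
    qed
  next
    fix e assume "e \<in> ?E \<union> ?E\<inverse>"
    then show "e \<in> A" using sym h(1,2) by (auto simp: L_L'_def)
  qed
  moreover have "card L = card L'"
  proof -
    have "l / (1 - l) \<noteq> 0" using l_pos l_less by simp
    then show ?thesis using S(4) S'(4) by (metis mult_right_cancel of_nat_eq_iff)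
  qed
  moreover have "v z = 0" if "z \<in> L \<union> L'" for z
    using that extremal_branch(2)[OF e, of z] extremal_branch(2)[OF e', of z] by (auto simp: L_L'_def)
  ultimately show thesis using that[of c x p L L'] dis fL V' vc S(2) S'(2) by blast
qed

end

section \<open>The first Dirichlet eigenvalue\<close>

text \<open>First-order condition for a minimum at \<open>t = 0\<close>: for \<open>d > 0\<close>
  with \<open>c \<le> d\<close>, the choice \<open>t = - b / d\<close> gives at most
  \<open>- (b\<^sup>2 / d)\<close>.\<close>

lemma linear_term_zero:
  fixes b c :: real
  assumes "\<And>t. 0 \<le> 2 * t * b + t\<^sup>2 * c"
  shows "b = 0"
proof -
  define d where "d = \<bar>c\<bar> + 1"
  have d: "0 < d" "c \<le> d" by (auto simp: d_def)
  have "0 \<le> 2 * (- b / d) * b + (- b / d)\<^sup>2 * c" by (rule assms)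
  also have "\<dots> \<le> 2 * (- b / d) * b + (- b / d)\<^sup>2 * d"
    using d by (intro add_left_mono mult_left_mono) auto
  also have "\<dots> = - (b\<^sup>2 / d)" using d by (simp add: field_simps power2_eq_square)
  finally show ?thesis using d by (simp add: divide_le_0_iff)
qed

text \<open>Tychonoff. Coordinates can be pinned to 0 by a degenerate interval, so functions on a
  finite vertex set can be treated as total functions.\<close>

lemma compact_box_fun: "compact {g :: 'v \<Rightarrow> real. \<forall>x. g x \<in> {a x..b x}}"
proof -
  have "compactin (product_topology (\<lambda>_. euclidean) UNIV) (PiE UNIV (\<lambda>x. {a x..b x}))"
    by (simp add: compactin_PiE)
  then have "compact (PiE UNIV (\<lambda>x. {a x..b x}))"
    by (simp add: euclidean_product_topology)
  moreover have "PiE UNIV (\<lambda>x. {a x..b x}) = {g. \<forall>x. g x \<in> {a x..b x}}" by auto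
  ultimately show ?thesis by simp
qed

text \<open>
  The eigenvector is a minimiser of the Rayleigh quotient, which does not increase under passing to
  absolute values.
\<close>

lemma nonneg_eigenvector_exists:
  fixes R :: "'v rel"
  assumes fin: "finite R" and sym: "\<And>x y. (x, y) \<in> R \<Longrightarrow> (y, x) \<in> R" and I: "finite I" "I \<noteq> {}"
  obtains f :: "'v \<Rightarrow> real" and lam where "\<And>x. 0 \<le> f x" "\<And>x. x \<notin> I \<Longrightarrow> f x = 0" "\<exists>x \<in> I. f x \<noteq> 0"
    "\<And>x. x \<in> I \<Longrightarrow> (\<Sum>y \<in> R `` {x}. f x - f y) = lam * f x"
proof -
  \<comment> \<open>Both arcs of each edge are counted, so this is twice the Dirichlet energy; hence
    the eigenvalue is \<open>lam / 2\<close> below.\<close>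
  define Q where "Q = (\<lambda>g :: 'v \<Rightarrow> real. \<Sum>e \<in> R. (g (fst e) - g (snd e))\<^sup>2)"
  define N where "N = (\<lambda>g :: 'v \<Rightarrow> real. \<Sum>x \<in> I. (g x)\<^sup>2)"
  define K where "K = {g. (\<forall>x. x \<notin> I \<longrightarrow> g x = 0) \<and> N g = 1}"
  define box where "box = {g. \<forall>x. g x \<in> {(if x \<in> I then -1 else 0)..(if x \<in> I then 1 else 0 :: real)}}"
  have contQ: "continuous_on X Q" for X
    unfolding Q_def by (intro continuous_intros continuous_on_subset[OF continuous_on_product_coordinates]) auto
  have contN: "continuous_on X N" for X
    unfolding N_def by (intro continuous_intros continuous_on_subset[OF continuous_on_product_coordinates]) auto
  \<comment> \<open>The unit sphere is a closed subset of a compact box.\<close>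
  have "K = box \<inter> {g. N g = 1}"
  proof (intro equalityI subsetI)
    fix g assume g: "g \<in> K"
    have "g x \<in> {- 1..1}" if "x \<in> I" for x
    proof -
      have "(g x)\<^sup>2 \<le> N g" unfolding N_def using that I by (intro member_le_sum) auto
      then have "\<bar>g x\<bar> \<le> 1" using g by (simp add: K_def abs_square_le_1)
      then show ?thesis by auto
    qed
    then show "g \<in> box \<inter> {g. N g = 1}" using g by (auto simp: K_def box_def)
  next
    fix g assume g: "g \<in> box \<inter> {g. N g = 1}"
    have "g x = 0" if "x \<notin> I" for x
    proof -
      have "g x \<in> {(if x \<in> I then -1 else 0)..(if x \<in> I then 1 else 0)}"
        using g unfolding box_def by blast
      then show ?thesis using that by simp
    qed
    then show "g \<in> K" using g by (simp add: K_def)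
  qed
  moreover have "compact box" unfolding box_def by (rule compact_box_fun)
  moreover have "closed {g. N g = 1}"
    by (intro closed_Collect_eq contN continuous_on_const)
  ultimately have cK: "compact K" by (simp add: compact_Int_closed)
  obtain x0 where x0: "x0 \<in> I" using I by auto
  have "(\<lambda>x. if x = x0 then 1 else 0) \<in> K"
    using x0 I by (auto simp: K_def N_def if_distrib[of "\<lambda>u. u\<^sup>2"] cong: if_cong)
  then obtain f0 where f0: "f0 \<in> K" "\<And>g. g \<in> K \<Longrightarrow> Q f0 \<le> Q g"
    using continuous_attains_inf[OF cK _ contQ] by auto
  define f where "f = (\<lambda>x. \<bar>f0 x\<bar>)"
  define lam where "lam = Q f"
  have fK: "f \<in> K" using f0(1) by (simp add: K_def f_def N_def)
  have "(\<bar>a\<bar> - \<bar>b\<bar>)\<^sup>2 \<le> (a - b)\<^sup>2" for a b :: real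
    using abs_triangle_ineq3[of a b] by (simp flip: abs_le_square_iff)
  then have "Q f \<le> Q f0" unfolding Q_def f_def by (intro sum_mono)
  then have fmin: "lam \<le> Q g" if "g \<in> K" for g using f0(2)[OF that] by (simp add: lam_def)
  have N0: "0 \<le> N g" for g unfolding N_def by (intro sum_nonneg) auto
  have ray: "lam * N g \<le> Q g" if g: "\<And>x. x \<notin> I \<Longrightarrow> g x = 0" for g
  proof (cases "N g = 0")
    case True
    then show ?thesis unfolding Q_def by (simp add: sum_nonneg)
  next
    case False
    then have pos: "0 < N g" using N0[of g] by simp
    define r where "r = 1 / sqrt (N g)"
    have r2: "r\<^sup>2 = 1 / N g" using pos by (simp add: r_def power_divide)
    have "N (\<lambda>x. r * g x) = r\<^sup>2 * N g" by (simp add: N_def power_mult_distrib sum_distrib_left)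
    then have "(\<lambda>x. r * g x) \<in> K" using g r2 pos by (simp add: K_def)
    then have "lam \<le> Q (\<lambda>x. r * g x)" by (rule fmin)
    also have "\<dots> = r\<^sup>2 * Q g"
      by (simp add: Q_def power_mult_distrib sum_distrib_left flip: right_diff_distrib)
    finally show ?thesis using r2 pos by (simp add: field_simps)
  qed
  have eig: "(\<Sum>y \<in> R `` {x}. f x - f y) = lam / 2 * f x" if x: "x \<in> I" for x
  proof -
    define d where "d = (\<lambda>z. if z = x then 1 else 0 :: real)"
    define b where "b = 2 * (\<Sum>y \<in> R `` {x}. f x - f y)"
    define c where "c = Q d"
    have Rx: "(\<Sum>e \<in> R. (f (fst e) - f (snd e)) * d (fst e)) = (\<Sum>y \<in> R `` {x}. f x - f y)"
    proof -
      have "(\<Sum>e \<in> R. (f (fst e) - f (snd e)) * d (fst e)) = (\<Sum>e \<in> Pair x ` (R `` {x}). f (fst e) - f (snd e))"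
        using fin by (intro sum.mono_neutral_cong_right) (auto simp: d_def)
      also have "\<dots> = (\<Sum>y \<in> R `` {x}. f x - f y)" by (subst sum.reindex) (auto simp: inj_on_def)
      finally show ?thesis .
    qed
    have "(\<Sum>e \<in> R. (f (fst e) - f (snd e)) * - d (snd e)) = (\<Sum>e \<in> R. (f (fst e) - f (snd e)) * d (fst e))"
      by (rule sum.reindex_bij_witness[of _ prod.swap prod.swap]) (auto simp: sym algebra_simps)
    then have cross: "(\<Sum>e \<in> R. (f (fst e) - f (snd e)) * (d (fst e) - d (snd e))) = b"
      using Rx by (simp add: b_def right_diff_distrib sum_subtractf sum_negf)
    \<comment> \<open>Perturb the minimiser at the single vertex \<open>x\<close> and expand energy
      and norm in \<open>t\<close>; the linear coefficient is the eigenvalue equation at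
      \<open>x\<close>.\<close>
    have "0 \<le> 2 * t * (b - lam * f x) + t\<^sup>2 * (c - lam)" for t
    proof -
      let ?g = "\<lambda>z. f z + t * d z"
      have "Q ?g = (\<Sum>e \<in> R. (f (fst e) - f (snd e))\<^sup>2 + (2 * t) * ((f (fst e) - f (snd e)) * (d (fst e) - d (snd e)))
                     + t\<^sup>2 * (d (fst e) - d (snd e))\<^sup>2)"
        unfolding Q_def by (intro sum.cong refl) (simp add: power2_eq_square algebra_simps)
      also have "\<dots> = lam + 2 * t * b + t\<^sup>2 * c"
        using cross by (simp add: sum.distrib lam_def c_def Q_def flip: sum_distrib_left)
      finally have Qg: "Q ?g = lam + 2 * t * b + t\<^sup>2 * c" .
      have "N ?g = (\<Sum>z \<in> I. (f z)\<^sup>2 + (if z = x then 2 * t * f x + t\<^sup>2 else 0))"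
        unfolding N_def by (intro sum.cong refl) (simp add: d_def power2_eq_square algebra_simps)
      also have "\<dots> = 1 + 2 * t * f x + t\<^sup>2"
        using fK x I by (simp add: sum.distrib K_def N_def)
      finally have Ng: "N ?g = 1 + 2 * t * f x + t\<^sup>2" .
      have "lam * N ?g \<le> Q ?g" using fK x by (intro ray) (auto simp: K_def d_def)
      then show ?thesis unfolding Qg Ng by (simp add: algebra_simps)
    qed
    then have "b - lam * f x = 0" by (rule linear_term_zero)
    then show ?thesis by (simp add: b_def)
  qed
  show thesis
  proof (rule that[of f "lam / 2"])
    show "\<exists>x \<in> I. f x \<noteq> 0"
    proof (rule ccontr)
      assume "\<not> ?thesis"
      then have "N f = 0" by (simp add: N_def)
      then show False using fK by (simp add: K_def)
    qed
  qed (use eig fK in \<open>auto simp: f_def K_def\<close>)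
qed

text \<open>
  Evaluate the eigenvalue equations at a vertex where \<open>\<bar>g\<bar> / f\<close> is maximal.
\<close>

lemma positive_eigenvector_least:
  fixes f g :: "'v \<Rightarrow> real"
  assumes I: "finite I" and R: "R \<subseteq> V \<times> V"
    and f: "\<And>x. x \<in> I \<Longrightarrow> 0 < f x" "\<And>x. x \<in> V - I \<Longrightarrow> f x = 0"
    and g: "x0 \<in> I" "g x0 \<noteq> 0" "\<And>x. x \<in> V - I \<Longrightarrow> g x = 0"
    and ef: "\<And>x. x \<in> I \<Longrightarrow> (\<Sum>y \<in> R `` {x}. f x - f y) = lam * f x"
    and eg: "\<And>x. x \<in> I \<Longrightarrow> (\<Sum>y \<in> R `` {x}. g x - g y) = mu * g x"
  shows "lam \<le> mu"
proof -
  define m where "m = Max ((\<lambda>x. \<bar>g x\<bar> / f x) ` I)"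
  have "m \<in> (\<lambda>x. \<bar>g x\<bar> / f x) ` I" unfolding m_def using I g(1) by (intro Max_in) auto
  then obtain x where x: "x \<in> I" "\<bar>g x\<bar> = m * f x" using f(1) by (force simp: field_simps)
  have mI: "\<bar>g y\<bar> / f y \<le> m" if "y \<in> I" for y unfolding m_def using I that by auto
  have "0 < \<bar>g x0\<bar> / f x0" using g f(1) by simp
  then have m: "0 < m" using mI[OF g(1)] by linarith
  have bound: "\<bar>g y\<bar> \<le> m * f y" if "y \<in> V" for y
  proof (cases "y \<in> I")
    case True then show ?thesis using mI[OF True] f(1)[OF True] by (simp add: pos_divide_le_eq)
  next
    case False then show ?thesis using that f(2)[of y] g(3)[of y] by simp
  qed
  \<comment> \<open>After multiplication by the sign of \<open>g x\<close>, \<open>g\<close> lies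
    below \<open>m * f\<close> everywhere on \<open>V\<close> and touches it at \<open>x\<close>, so
    the differences at \<open>x\<close> can be compared term by term.\<close>
  define \<sigma> where "\<sigma> = sgn (g x)"
  have \<sigma>: "\<sigma> * g x = m * f x" "\<And>y. y \<in> V \<Longrightarrow> \<sigma> * g y \<le> m * f y"
  proof -
    show "\<sigma> * g x = m * f x" using x(2) by (simp add: \<sigma>_def mult.commute[of "sgn _"] flip: abs_sgn)
    fix y assume "y \<in> V"
    have "\<sigma> * g y \<le> \<bar>g y\<bar>" unfolding \<sigma>_def by (cases "g x" "0 :: real" rule: linorder_cases) auto
    then show "\<sigma> * g y \<le> m * f y" using bound[OF \<open>y \<in> V\<close>] by linarith
  qed
  have "m * (lam * f x) = (\<Sum>y \<in> R `` {x}. m * f x - m * f y)"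
    using ef[OF x(1)] by (simp flip: sum_distrib_left right_diff_distrib)
  also have "\<dots> \<le> (\<Sum>y \<in> R `` {x}. \<sigma> * g x - \<sigma> * g y)"
    using \<sigma> R by (intro sum_mono) auto
  also have "\<dots> = \<sigma> * (mu * g x)"
    using eg[OF x(1)] by (simp flip: sum_distrib_left right_diff_distrib)
  also have "\<dots> = mu * (m * f x)" by (simp flip: \<sigma>(1))
  finally have "lam * (m * f x) \<le> mu * (m * f x)" by (simp add: ac_simps)
  then show ?thesis using m f(1)[OF x(1)] by simp
qed

section \<open>Identifying the least Dirichlet eigenvalue\<close>

lemma dirichlet_eigenvalue_alt:
  "dirichlet_eigenvalue T lam \<longleftrightarrow> (\<exists>f. (\<exists>x \<in> pverts T. f x \<noteq> 0) \<and> (\<forall>x \<in> leaf_verts T. f x = 0) \<and>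
     (\<forall>x \<in> interior_verts T. (\<Sum>y \<in> parcs T `` {x}. f x - f y) = lam * f x))"
  by (simp add: dirichlet_eigenvalue_def Image_singleton)

text \<open>A positive eigenvector both attains \<open>lam\<close> and bounds all other eigenvalues
  from below, so the \<open>LEAST\<close> is a genuine minimum.\<close>

lemma first_dirichlet_eigenvalueI:
  assumes "finite (pverts T)" "parcs T \<subseteq> pverts T \<times> pverts T" "interior_verts T \<noteq> {}"
    and f: "\<And>x. x \<in> interior_verts T \<Longrightarrow> 0 < f x" "\<And>x. x \<in> leaf_verts T \<Longrightarrow> f x = 0"
    and ef: "\<And>x. x \<in> interior_verts T \<Longrightarrow> (\<Sum>y \<in> parcs T `` {x}. f x - f y) = lam * f x"
  shows "first_dirichlet_eigenvalue T = lam"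
  unfolding first_dirichlet_eigenvalue_def
proof (rule Least_equality)
  show "dirichlet_eigenvalue T lam"
    unfolding dirichlet_eigenvalue_alt
  proof (intro exI[of _ f] conjI)
    obtain x where "x \<in> interior_verts T" using assms(3) by auto
    then show "\<exists>x \<in> pverts T. f x \<noteq> 0" using f(1)[of x] by (intro bexI[of _ x]) (auto simp: interior_verts_def)
  qed (use f ef in auto)
  fix mu assume "dirichlet_eigenvalue T mu"
  then obtain g x0 where g: "x0 \<in> pverts T" "g x0 \<noteq> 0" "\<And>x. x \<in> leaf_verts T \<Longrightarrow> g x = 0"
    "\<And>x. x \<in> interior_verts T \<Longrightarrow> (\<Sum>y \<in> parcs T `` {x}. g x - g y) = mu * g x"
    unfolding dirichlet_eigenvalue_alt by blast
  have L: "x \<in> pverts T - interior_verts T \<Longrightarrow> x \<in> leaf_verts T" for x by (auto simp: interior_verts_def)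
  show "lam \<le> mu"
  proof (rule positive_eigenvector_least[where I = "interior_verts T" and V = "pverts T" and R = "parcs T" and f = f and g = g])
    show "finite (interior_verts T)" using assms(1) by (simp add: interior_verts_def)
    show "x0 \<in> interior_verts T" using g(1-3) by (auto simp: interior_verts_def)
  qed (use assms g L in auto)
qed

section \<open>The tree of interior vertices\<close>

text \<open>The walk is built by prepending arcs. If the new start vertex already occurs, the suffix
  from its occurrence is used instead.\<close>

lemma rtrancl_imp_simple_walk:
  assumes "(x, y) \<in> R\<^sup>*"
  obtains p where "pcas x p y" "set p \<subseteq> R" "distinct (pawalk_verts x p)"
proof -
  have suffix: "\<exists>q. pcas u q y \<and> set q \<subseteq> set p \<and> distinct (pawalk_verts u q)"
    if "pcas z p y" "distinct (pawalk_verts z p)" "u \<in> set (pawalk_verts z p)" for u z p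
    using that
  proof (induction p arbitrary: z)
    case Nil then show ?case by (intro exI[of _ "[]"]) auto
  next
    case (Cons e p)
    show ?case
    proof (cases "u = z")
      case True then show ?thesis using Cons.prems by (intro exI[of _ "e # p"]) auto
    next
      case False
      then obtain q where "pcas u q y \<and> set q \<subseteq> set p \<and> distinct (pawalk_verts u q)"
        using Cons.IH[of "snd e"] Cons.prems by auto
      then show ?thesis by (intro exI[of _ q]) auto
    qed
  qed
  from assms have "\<exists>p. pcas x p y \<and> set p \<subseteq> R \<and> distinct (pawalk_verts x p)"
  proof (induction rule: converse_rtrancl_induct)
    case base then show ?case by (intro exI[of _ "[]"]) auto
  next
    case (step x z)
    then obtain p where p: "pcas z p y" "set p \<subseteq> R" "distinct (pawalk_verts z p)" by blast
    show ?case
    proof (cases "x \<in> set (pawalk_verts z p)")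
      case True
      then show ?thesis using suffix[OF p(1,3) True] p(2) by blast
    next
      case False
      then show ?thesis using p step(1) by (intro exI[of _ "(x, z) # p"]) auto
    qed
  qed
  then show thesis using that by blast
qed

lemma out_degree_with_proj: "out_degree (with_proj T) x = card (parcs T `` {x})"
proof -
  have "out_arcs (with_proj T) x = Pair x ` (parcs T `` {x})" by (auto simp: out_arcs_def)
  then show ?thesis unfolding out_degree_def by (simp add: card_image inj_on_def)
qed

lemma mem_leaf_verts: "x \<in> leaf_verts T \<longleftrightarrow> x \<in> pverts T \<and> card (parcs T `` {x}) = 1"
  by (simp add: leaf_verts_def out_degree_with_proj)

lemma verts_eq: "pverts T = interior_verts T \<union> leaf_verts T"
  and interior_leaf_disjoint: "interior_verts T \<inter> leaf_verts T = {}"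
  by (auto simp: interior_verts_def leaf_verts_def)

text \<open>A nonempty interior excludes the single edge, whose two leaves have no interior
  neighbour.\<close>

locale interior_tree =
  fixes T :: "'v pair_pre_digraph"
  assumes tree: "undirected_tree T" and interior: "interior_verts T \<noteq> {}"
begin

sublocale G: pair_graph T
  using tree by (simp add: undirected_tree_def)

abbreviation "I \<equiv> interior_verts T"
abbreviation "R \<equiv> parcs T"

definition "A = R \<inter> I \<times> I"

definition "leaves x = R `` {x} \<inter> leaf_verts T"

lemma R_sym: "(x, y) \<in> R \<Longrightarrow> (y, x) \<in> R"
  using G.pair_sym_arcs by (auto simp: symmetric_def elim: symE)

lemma R_sub: "R \<subseteq> pverts T \<times> pverts T"
  using G.in_arcsD1 G.in_arcsD2 by auto

lemma fin_I: "finite I"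
  using G.pair_finite_verts by (simp add: interior_verts_def)

lemma fin_R: "finite (R `` {x})"
  using G.pair_finite_arcs by (simp add: finite_Image)

lemma R_conn: "x \<in> pverts T \<Longrightarrow> y \<in> pverts T \<Longrightarrow> (x, y) \<in> R\<^sup>*"
proof -
  have "strongly_connected (with_proj T)"
    using G.symmetric_connected_imp_strongly_connected G.pair_sym_arcs tree
    by (simp add: undirected_tree_def)
  then show "x \<in> pverts T \<Longrightarrow> y \<in> pverts T \<Longrightarrow> (x, y) \<in> R\<^sup>*"
    using reachable_rtranclI[of "with_proj T" x y] by (auto simp: strongly_connected_def)
qed

text \<open>A simple detour from \<open>x\<close> to \<open>y\<close> avoiding the edge is closed up
  by the arc \<open>(y, x)\<close>. The detour has at least two arcs, so the cycle is not one of the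
  spurious cycles of length 2.\<close>

lemma R_bridge:
  assumes "(x, y) \<in> R"
  shows "(x, y) \<notin> (R - {(x, y), (y, x)})\<^sup>*"
proof
  assume "(x, y) \<in> (R - {(x, y), (y, x)})\<^sup>*"
  then obtain p where p: "pcas x p y" "set p \<subseteq> R - {(x, y), (y, x)}" "distinct (pawalk_verts x p)"
    by (rule rtrancl_imp_simple_walk)
  have xy: "x \<noteq> y" using G.pair_no_loops[OF assms] by simp
  have "2 \<le> length p"
  proof (rule ccontr)
    assume "\<not> 2 \<le> length p"
    then consider "p = []" | e where "p = [e]" by (cases p rule: remdups_adj.cases) auto
    then show False using p xy by cases auto
  qed
  moreover have "G.awalk y ((y, x) # p) y"
    using p R_sym[OF assms] R_sub by (auto simp: G.awalk_def)
  then have "G.cycle ((y, x) # p)" using p(3) by (auto simp: G.cycle_def)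
  ultimately show False using tree by (auto simp: undirected_tree_def)
qed

text \<open>Two adjacent leaves would form a whole component, yet an interior vertex is reachable
  from them.\<close>

lemma leaf_neighbour:
  assumes "z \<in> leaf_verts T"
  obtains u where "u \<in> I" "R `` {z} = {u}"
proof -
  obtain u where u: "R `` {z} = {u}" using assms by (auto simp: mem_leaf_verts card_1_singleton_iff)
  have "u \<in> I"
  proof (rule ccontr)
    assume "u \<notin> I"
    have "(z, u) \<in> R" using u by auto
    then have "u \<in> pverts T" using R_sub by auto
    then have "u \<in> leaf_verts T" using \<open>u \<notin> I\<close> by (simp add: interior_verts_def)
    then obtain u' where "R `` {u} = {u'}" by (auto simp: mem_leaf_verts card_1_singleton_iff)
    moreover have "z \<in> R `` {u}" using R_sym[OF \<open>(z, u) \<in> R\<close>] by auto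
    ultimately have u': "R `` {u} = {z}" by auto
    obtain r where r: "r \<in> I" using interior by auto
    then have "(z, r) \<in> R\<^sup>*" using assms by (intro R_conn) (auto simp: interior_verts_def leaf_verts_def)
    then have "r \<in> {z, u}" by induction (use u u' in auto)
    then show False using r assms \<open>u \<in> leaf_verts T\<close> by (auto simp: interior_verts_def)
  qed
  then show thesis using that u by blast
qed

lemma A_sym: "(x, y) \<in> A \<Longrightarrow> (y, x) \<in> A"
  using R_sym by (auto simp: A_def)

lemma A_conn:
  assumes "x \<in> I" "y \<in> I"
  shows "(x, y) \<in> A\<^sup>*"
proof -
  have "(x, y) \<in> R\<^sup>*" using assms by (intro R_conn) (auto simp: interior_verts_def)
  \<comment> \<open>Invariant for walks through leaves: a walk leaves a leaf only to the neighbour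
    it came from, so at a leaf it suffices to track reachability of that neighbour.\<close>
  then have "(y \<in> I \<longrightarrow> (x, y) \<in> A\<^sup>*) \<and> (y \<in> leaf_verts T \<longrightarrow> (\<forall>u. (y, u) \<in> R \<longrightarrow> (x, u) \<in> A\<^sup>*))"
  proof induction
    case base then show ?case using assms(1) by (auto simp: interior_verts_def)
  next
    case (step z w)
    have zw: "z \<in> pverts T" "w \<in> pverts T" using step(2) R_sub by auto
    show ?case
    proof (cases "w \<in> leaf_verts T")
      case True
      then obtain u where u: "u \<in> I" "R `` {w} = {u}" by (rule leaf_neighbour)
      then have "z = u" using R_sym[OF step(2)] by auto
      then show ?thesis using u step.IH True by (auto simp: interior_verts_def)
    next
      case False
      then have w: "w \<in> I" using zw by (simp add: interior_verts_def)
      show ?thesis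
      proof (cases "z \<in> I")
        case True
        then have "(z, w) \<in> A" using w step(2) by (simp add: A_def)
        then show ?thesis using step.IH True False by auto
      next
        case z: False
        then have "z \<in> leaf_verts T" using zw by (simp add: interior_verts_def)
        then show ?thesis using step.IH step(2) False by auto
      qed
    qed
  qed
  then show ?thesis using assms(2) by simp
qed

sublocale bridge_graph I A
proof
  show "finite I" by (rule fin_I)
  show "A \<subseteq> I \<times> I" by (auto simp: A_def)
  show "(x, y) \<in> A \<Longrightarrow> (y, x) \<in> A" for x y by (rule A_sym)
  show "x \<in> I \<Longrightarrow> y \<in> I \<Longrightarrow> (x, y) \<in> A\<^sup>*" for x y by (rule A_conn)
  show "(x, y) \<notin> (A - {(x, y), (y, x)})\<^sup>*" if "(x, y) \<in> A" for x y
  proof -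
    have "(A - {(x, y), (y, x)})\<^sup>* \<subseteq> (R - {(x, y), (y, x)})\<^sup>*"
      by (rule rtrancl_mono) (auto simp: A_def)
    moreover have "(x, y) \<in> R" using that by (simp add: A_def)
    ultimately show ?thesis using R_bridge by blast
  qed
qed

section \<open>Leaf counts and the ground state on the interior\<close>

lemma neighbours: "x \<in> I \<Longrightarrow> R `` {x} = A `` {x} \<union> leaves x" "A `` {x} \<inter> leaves x = {}"
  using R_sub verts_eq[of T] interior_leaf_disjoint[of T] by (auto simp: A_def leaves_def)

lemma leaves_disjoint: "x \<in> I \<Longrightarrow> y \<in> I \<Longrightarrow> x \<noteq> y \<Longrightarrow> leaves x \<inter> leaves y = {}"
proof (rule ccontr)
  assume "x \<noteq> y" "leaves x \<inter> leaves y \<noteq> {}"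
  then obtain z where z: "z \<in> leaf_verts T" "(x, z) \<in> R" "(y, z) \<in> R" by (auto simp: leaves_def)
  obtain u where "R `` {z} = {u}" using leaf_neighbour[OF z(1)] by blast
  moreover have "x \<in> R `` {z}" "y \<in> R `` {z}" using z R_sym by auto
  ultimately show False using \<open>x \<noteq> y\<close> by auto
qed

lemma leaves_UN: "(\<Union>x \<in> I. leaves x) = leaf_verts T"
proof (intro equalityI subsetI)
  fix z assume z: "z \<in> leaf_verts T"
  then obtain u where "u \<in> I" "R `` {z} = {u}" by (rule leaf_neighbour)
  moreover then have "(u, z) \<in> R" using R_sym by auto
  ultimately show "z \<in> (\<Union>x \<in> I. leaves x)" using z by (auto simp: leaves_def)
qed (auto simp: leaves_def)

lemma fin_leaves: "finite (leaves x)"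
  using fin_R by (simp add: leaves_def)

lemma sum_leaves: "(\<Sum>x \<in> I. card (leaves x)) = card (leaf_verts T)"
  using leaves_UN card_UN_disjoint[OF fin_I, of leaves] fin_leaves leaves_disjoint by auto

text \<open>At a zero of a nonnegative eigenvector the neighbouring values sum to 0, so zeros spread
  through the connected interior and \<open>f\<close> is positive. Each leaf at \<open>x\<close>
  contributes \<open>f x\<close>, which turns the leaf count into a potential.\<close>

lemma ground_state_exists:
  obtains f where "\<And>x. x \<in> I \<Longrightarrow> 0 < f x"
    "\<And>x. x \<in> I \<Longrightarrow> real (card (leaves x)) * f x + (\<Sum>y \<in> A `` {x}. f x - f y)
        = first_dirichlet_eigenvalue T * f x"
proof -
  obtain f :: "'v \<Rightarrow> real" and lam where f: "\<And>x. 0 \<le> f x" "\<And>x. x \<notin> I \<Longrightarrow> f x = 0" "\<exists>x \<in> I. f x \<noteq> 0"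
    "\<And>x. x \<in> I \<Longrightarrow> (\<Sum>y \<in> R `` {x}. f x - f y) = lam * f x"
    using nonneg_eigenvector_exists[OF G.pair_finite_arcs R_sym fin_I interior] by metis
  have nbr0: "f y = 0" if "x \<in> I" "f x = 0" "(x, y) \<in> R" for x y
  proof -
    have "(\<Sum>y \<in> R `` {x}. f y) = 0" using f(4)[OF that(1)] that(2) by (simp add: sum_negf)
    then have "\<forall>y \<in> R `` {x}. f y = 0" using fin_R f(1) by (subst (asm) sum_nonneg_eq_0_iff) auto
    then show ?thesis using that(3) by auto
  qed
  have pos: "0 < f x" if x: "x \<in> I" for x
  proof (rule ccontr)
    assume "\<not> 0 < f x"
    then have fx: "f x = 0" using f(1)[of x] by simp
    obtain z where z: "z \<in> I" "f z \<noteq> 0" using f(3) by auto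
    have "(x, z) \<in> A\<^sup>*" using x z A_conn by simp
    then have "f z = 0" by induction (use fx nbr0 in \<open>auto simp: A_def\<close>)
    then show False using z by simp
  qed
  have leaf0: "f x = 0" if "x \<in> leaf_verts T" for x using f(2)[of x] that by (simp add: interior_verts_def)
  have lam: "first_dirichlet_eigenvalue T = lam"
    by (rule first_dirichlet_eigenvalueI[where f = f])
      (use G.pair_finite_verts R_sub interior pos f(4) leaf0 in auto)
  show thesis
  proof (rule that[of f])
    fix x assume x: "x \<in> I"
    have "(\<Sum>y \<in> R `` {x}. f x - f y) = (\<Sum>y \<in> A `` {x}. f x - f y) + (\<Sum>y \<in> leaves x. f x - f y)"
      using neighbours(1)[OF x] neighbours(2)[of x] fin_A fin_leaves
      by (simp add: sum.union_disjoint finite_Image)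
    also have "(\<Sum>y \<in> leaves x. f x - f y) = (\<Sum>y \<in> leaves x. f x)"
      by (intro sum.cong refl) (auto simp: leaves_def leaf0)
    finally show "real (card (leaves x)) * f x + (\<Sum>y \<in> A `` {x}. f x - f y)
        = first_dirichlet_eigenvalue T * f x"
      using f(4)[OF x] lam by simp
  qed (rule pos)
qed

theorem first_eigenvalue_bound:
  assumes k: "card I = k" "5 \<le> k" and b: "card (leaf_verts T) = a * k + 2"
    and mu: "0 < mu" "mu < 1" "bound_fun k mu = 2"
  shows "first_dirichlet_eigenvalue T \<le> a + mu"
    and "first_dirichlet_eigenvalue T = a + mu \<Longrightarrow> \<exists>c x p L L'.
      distinct [c, x, p] \<and> finite L \<and> finite L' \<and> L \<inter> L' = {} \<and>
      {c, x, p} \<inter> (L \<union> L') = {} \<and> I = {c, x, p} \<union> L \<union> L' \<and>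
      A = ({(c, x), (c, p)} \<union> {x} \<times> L \<union> {p} \<times> L') \<union> ({(c, x), (c, p)} \<union> {x} \<times> L \<union> {p} \<times> L')\<inverse> \<and>
      card L = card L' \<and> card (leaves c) = a \<and> card (leaves x) = a + 1 \<and> card (leaves p) = a + 1 \<and>
      (\<forall>z \<in> L \<union> L'. card (leaves z) = a)"
proof -
  obtain f where f: "\<And>x. x \<in> I \<Longrightarrow> 0 < f x"
    "\<And>x. x \<in> I \<Longrightarrow> real (card (leaves x)) * f x + (\<Sum>y \<in> A `` {x}. f x - f y)
        = first_dirichlet_eigenvalue T * f x"
    using ground_state_exists by blast
  define l where "l = first_dirichlet_eigenvalue T - a"
  define v where "v = (\<lambda>x. int (card (leaves x)) - int a)"
  \<comment> \<open>Subtracting \<open>a\<close> from every leaf count leaves total mass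
    \<open>b - a * k = 2\<close> and shifts the eigenvalue by \<open>a\<close>. For
    \<open>l \<le> 0\<close> the bound is immediate because \<open>mu > 0\<close>.\<close>
  have gs: "ground_state I A v f l" if "0 < l"
  proof
    show "5 \<le> card I" using k by simp
    have "sum v I = int (\<Sum>x \<in> I. card (leaves x)) - int a * card I"
      by (simp add: v_def sum_subtractf)
    also have "\<dots> = 2" unfolding sum_leaves b k(1) by simp
    finally show "sum v I = 2" .
    show "real_of_int (v x) * f x + (\<Sum>y \<in> A `` {x}. f x - f y) = l * f x" if "x \<in> I" for x
      using f(2)[OF that] by (simp add: v_def l_def algebra_simps)
  qed (use that f(1) in auto)
  have le: "l \<le> mu"
  proof (rule ccontr)
    assume "\<not> l \<le> mu"
    then have l: "0 < l" "mu < l" using mu by auto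
    interpret ground_state I A v f l by (rule gs[OF l(1)])
    have "bound_fun k l \<le> 2" using eigenvalue_dichotomy k(1) by (auto simp: bound_fun_def)
    then show False using bound_fun_strict_mono[of k mu l] mu l l_less k(2) by simp
  qed
  then show "first_dirichlet_eigenvalue T \<le> a + mu" by (simp add: l_def)
  assume "first_dirichlet_eigenvalue T = a + mu"
  then have lm: "l = mu" by (simp add: l_def)
  interpret ground_state I A v f l by (rule gs) (use lm mu in simp)
  have "bound_fun k l = 2" using lm mu by simp
  then obtain x y p q where "extremal_pair x y p q"
    using eigenvalue_dichotomy k(1) by (auto simp: bound_fun_def)
  then obtain c x p L L' where S:
    "distinct [c, x, p]" "finite L" "finite L'" "L \<inter> L' = {}"
    "{c, x, p} \<inter> (L \<union> L') = {}" "I = {c, x, p} \<union> L \<union> L'"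
    "A = ({(c, x), (c, p)} \<union> {x} \<times> L \<union> {p} \<times> L') \<union> ({(c, x), (c, p)} \<union> {x} \<times> L \<union> {p} \<times> L')\<inverse>"
    "card L = card L'" and vv: "v c = 0" "v x = 1" "v p = 1" "\<forall>z \<in> L \<union> L'. v z = 0"
    by (rule extremal_structure)
  have "card (leaves c) = a" "card (leaves x) = a + 1" "card (leaves p) = a + 1"
    "\<forall>z \<in> L \<union> L'. card (leaves z) = a"
    using vv by (auto simp: v_def)
  with S show "\<exists>c x p L L'.
      distinct [c, x, p] \<and> finite L \<and> finite L' \<and> L \<inter> L' = {} \<and>
      {c, x, p} \<inter> (L \<union> L') = {} \<and> I = {c, x, p} \<union> L \<union> L' \<and>
      A = ({(c, x), (c, p)} \<union> {x} \<times> L \<union> {p} \<times> L') \<union> ({(c, x), (c, p)} \<union> {x} \<times> L \<union> {p} \<times> L')\<inverse> \<and>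
      card L = card L' \<and> card (leaves c) = a \<and> card (leaves x) = a + 1 \<and> card (leaves p) = a + 1 \<and>
      (\<forall>z \<in> L \<union> L'. card (leaves z) = a)"
    by blast
qed

end

section \<open>Star-like path trees\<close>

lemma wf_SLP: "pair_wf_digraph (SLP p q c d e)"
proof -
  have "slp_edges p q c d e \<subseteq> pverts (SLP p q c d e) \<times> pverts (SLP p q c d e)"
    by (auto simp: slp_edges_def SLP_def slp_core_def)
  then have "parcs (SLP p q c d e) \<subseteq> pverts (SLP p q c d e) \<times> pverts (SLP p q c d e)"
    by (auto simp: SLP_def)
  then show ?thesis by unfold_locales auto
qed

lemma SLP_sub: "parcs (SLP p q c d e) \<subseteq> pverts (SLP p q c d e) \<times> pverts (SLP p q c d e)"
  using pair_wf_digraph.in_arcsD1[OF wf_SLP] pair_wf_digraph.in_arcsD2[OF wf_SLP] by auto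

lemma pverts_SLP:
  "pverts (SLP p q c d e) = slp_core c d e \<union>
     (\<Union>v \<in> slp_core c d e. Pendant v ` {1..slp_pendants p q c v})"
  by (auto simp: SLP_def)

lemma finite_SLP: "finite (pverts (SLP p q c d e))"
  unfolding pverts_SLP by (auto simp: slp_core_def)

lemma slp_core_2: "slp_core 2 d e = {Spine 0, Spine 1, Spine 2} \<union> ArmL ` {1..d} \<union> ArmR ` {1..e}"
proof -
  have "{0..2 :: nat} = {0, 1, 2}" by auto
  then show ?thesis by (simp add: slp_core_def del: One_nat_def)
qed

lemma slp_edges_2:
  "slp_edges p q 2 d e = {(Spine 0, Spine 1), (Spine 1, Spine 2)} \<union> {Spine 0} \<times> ArmL ` {1..d}
     \<union> {Spine 2} \<times> ArmR ` {1..e} \<union> (SIGMA v:slp_core 2 d e. Pendant v ` {1..slp_pendants p q 2 v})"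
proof -
  have "{(Spine i, Spine (Suc i)) | i. i < 2} = {(Spine 0, Spine 1), (Spine 1, Spine 2)}"
    by (auto simp: less_2_cases_iff numeral_2_eq_2)
  moreover have "{(Spine 0, ArmL i) | i. i \<in> {1..d}} = {Spine 0} \<times> ArmL ` {1..d}"
    "{(Spine 2, ArmR i) | i. i \<in> {1..e}} = {Spine 2} \<times> ArmR ` {1..e}"
    "{(v, Pendant v i) | v i. v \<in> slp_core 2 d e \<and> i \<in> {1..slp_pendants p q 2 v}}
      = (SIGMA v:slp_core 2 d e. Pendant v ` {1..slp_pendants p q 2 v})"
    by auto
  ultimately show ?thesis by (simp only: slp_edges_def)
qed

lemma SLP_neighbours:
  "parcs (SLP p q c d e) `` {x} = {y. (x, y) \<in> slp_edges p q c d e} \<union> {y. (y, x) \<in> slp_edges p q c d e}"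
  by (auto simp: SLP_def)

lemma SLP_neighbours_spine:
  "parcs (SLP p q 2 d e) `` {Spine 0} = {Spine 1} \<union> ArmL ` {1..d} \<union> Pendant (Spine 0) ` {1..p}"
  "parcs (SLP p q 2 d e) `` {Spine 1} = {Spine 0, Spine 2} \<union> Pendant (Spine 1) ` {1..q}"
  "parcs (SLP p q 2 d e) `` {Spine 2} = {Spine 1} \<union> ArmR ` {1..e} \<union> Pendant (Spine 2) ` {1..p}"
  unfolding SLP_neighbours slp_edges_2 by (auto simp: slp_core_2 slp_pendants_def)

lemma SLP_neighbours_arm:
  "i \<in> {1..d} \<Longrightarrow> parcs (SLP p q 2 d e) `` {ArmL i} = {Spine 0} \<union> Pendant (ArmL i) ` {1..q}"
  "i \<in> {1..e} \<Longrightarrow> parcs (SLP p q 2 d e) `` {ArmR i} = {Spine 2} \<union> Pendant (ArmR i) ` {1..q}"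
  unfolding SLP_neighbours slp_edges_2 by (auto simp: slp_core_2 slp_pendants_def)

lemma SLP_neighbours_pendant:
  "v \<in> slp_core 2 d e \<Longrightarrow> i \<in> {1..slp_pendants p q 2 v} \<Longrightarrow>
     parcs (SLP p q 2 d e) `` {Pendant v i} = {v}"
  unfolding SLP_neighbours slp_edges_2 by (auto simp: slp_core_2)

text \<open>Every core vertex has two explicit neighbours; at the ends and on the arms one of them
  is a pendant, which exists since \<open>p\<close> and \<open>q\<close> are positive.\<close>

lemma leaf_verts_SLP:
  assumes "1 \<le> p" "1 \<le> q"
  shows "leaf_verts (SLP p q 2 d e) = (\<Union>v \<in> slp_core 2 d e. Pendant v ` {1..slp_pendants p q 2 v})"
    (is "?L = ?P")
proof (intro equalityI subsetI)
  let ?R = "parcs (SLP p q 2 d e)"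
  have two: "card (?R `` {v}) \<noteq> 1" if "v \<in> slp_core 2 d e" for v
  proof -
    have "\<exists>a b. a \<in> ?R `` {v} \<and> b \<in> ?R `` {v} \<and> a \<noteq> b"
      using that unfolding slp_core_2
    proof (elim UnE imageE insertE emptyE; hypsubst)
      show "\<exists>a b. a \<in> ?R `` {Spine 0} \<and> b \<in> ?R `` {Spine 0} \<and> a \<noteq> b"
        using assms unfolding SLP_neighbours_spine
        by (intro exI[of _ "Spine 1"] exI[of _ "Pendant (Spine 0) 1"]) auto
      show "\<exists>a b. a \<in> ?R `` {Spine 1} \<and> b \<in> ?R `` {Spine 1} \<and> a \<noteq> b"
        unfolding SLP_neighbours_spine by (intro exI[of _ "Spine 0"] exI[of _ "Spine 2"]) auto
      show "\<exists>a b. a \<in> ?R `` {Spine 2} \<and> b \<in> ?R `` {Spine 2} \<and> a \<noteq> b"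
        using assms unfolding SLP_neighbours_spine
        by (intro exI[of _ "Spine 1"] exI[of _ "Pendant (Spine 2) 1"]) auto
      show "\<exists>a b. a \<in> ?R `` {ArmL i} \<and> b \<in> ?R `` {ArmL i} \<and> a \<noteq> b" if "i \<in> {1..d}" for i
        using assms unfolding SLP_neighbours_arm(1)[OF that]
        by (intro exI[of _ "Spine 0"] exI[of _ "Pendant (ArmL i) 1"]) auto
      show "\<exists>a b. a \<in> ?R `` {ArmR i} \<and> b \<in> ?R `` {ArmR i} \<and> a \<noteq> b" if "i \<in> {1..e}" for i
        using assms unfolding SLP_neighbours_arm(2)[OF that]
        by (intro exI[of _ "Spine 2"] exI[of _ "Pendant (ArmR i) 1"]) auto
    qed
    then show ?thesis by (metis card_1_singletonE singletonD)
  qed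
  show "v \<in> ?P" if "v \<in> ?L" for v
    using that two[of v] unfolding mem_leaf_verts pverts_SLP by blast
  show "v \<in> ?L" if v: "v \<in> ?P" for v
  proof -
    have "v \<in> pverts (SLP p q 2 d e)" unfolding pverts_SLP using v by blast
    moreover obtain u i where "v = Pendant u i" "u \<in> slp_core 2 d e" "i \<in> {1..slp_pendants p q 2 u}"
      using v by blast
    ultimately show ?thesis unfolding mem_leaf_verts by (simp add: SLP_neighbours_pendant)
  qed
qed

lemma interior_verts_SLP:
  assumes "1 \<le> p" "1 \<le> q"
  shows "interior_verts (SLP p q 2 d e) = slp_core 2 d e"
  unfolding interior_verts_def leaf_verts_SLP[OF assms] pverts_SLP
  by (auto simp: slp_core_def)

text \<open>An eigenvector with value 1 at both hubs is written down. The equations at the centre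
  and on the arms fix its other values, and the equation at a hub is then equivalent to
  \<open>bound_fun k mu = 2\<close>.\<close>

lemma SLP_first_eigenvalue:
  assumes "1 \<le> a" and k: "k = 2 * m + 3" and mu: "0 < mu" "mu < 1" "bound_fun k mu = 2"
  shows "first_dirichlet_eigenvalue (SLP (a + 1) a 2 m m) = a + mu"
proof -
  define T where "T = SLP (a + 1) a 2 m m"
  \<comment> \<open>The values at the centre and on the arms, as dictated by the equality case:
    \<open>s = mu / 2\<close> from hub to centre and \<open>s = mu\<close> from hub to arm.\<close>
  define c r where "c = 1 / (1 - mu / 2)" "r = 1 / (1 - mu)"
  have cr: "c * (2 - mu) = 2" "r * (1 - mu) = 1" "0 < c" "0 < r"
    using mu by (auto simp: c_r_def field_simps)
  have step: "2 * (c - 1) = mu * c" "r - 1 = mu * r" using cr(1,2) by (simp_all add: algebra_simps)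
  have "psi mu = r - 1 - mu" "psi (mu / 2) = c - 1 - mu / 2"
    using mu by (simp_all add: psi_alt c_r_def)
  then have "mu * (2 * m + 3) + 2 * m * (r - 1 - mu) + 2 * (c - 1 - mu / 2) = 2"
    using mu(3) by (simp add: bound_fun_def k)
  then have hub: "m * (r - 1) = 2 - mu - c" by (simp add: algebra_simps)
  define f :: "slp_vertex \<Rightarrow> real" where
    "f = (\<lambda>v. case v of Spine i \<Rightarrow> if i = 1 then c else 1 | ArmL i \<Rightarrow> r | ArmR i \<Rightarrow> r | Pendant u i \<Rightarrow> 0)"
  have fs: "f (Spine 0) = 1" "f (Spine 1) = c" "f (Spine 2) = 1" "f (ArmL i) = r" "f (ArmR i) = r"
    "f (Pendant u i) = 0" for i u by (auto simp: f_def)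
  have P: "(\<Sum>y \<in> Pendant u ` {1..n}. x - f y) = n * x" for u n and x :: real
    by (subst sum.reindex) (auto simp: inj_on_def fs)
  have L: "(\<Sum>y \<in> ArmL ` {1..n}. x - f y) = n * (x - r)" "(\<Sum>y \<in> ArmR ` {1..n}. x - f y) = n * (x - r)"
    for n and x :: real
    by (subst sum.reindex; auto simp: inj_on_def fs)+
  have I: "interior_verts T = slp_core 2 m m" unfolding T_def by (rule interior_verts_SLP) (use assms in auto)
  have "first_dirichlet_eigenvalue T = a + mu"
  proof (rule first_dirichlet_eigenvalueI[where f = f])
    show "finite (pverts T)" "parcs T \<subseteq> pverts T \<times> pverts T"
      unfolding T_def by (rule finite_SLP, rule SLP_sub)
    show "interior_verts T \<noteq> {}" unfolding I by (auto simp: slp_core_2)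
    show "0 < f x" if "x \<in> interior_verts T" for x
      using that cr by (auto simp: I slp_core_2 fs simp del: One_nat_def)
    show "f x = 0" if "x \<in> leaf_verts T" for x
    proof -
      have "leaf_verts T = (\<Union>v \<in> slp_core 2 m m. Pendant v ` {1..slp_pendants (a + 1) a 2 v})"
        unfolding T_def by (rule leaf_verts_SLP) (use assms in auto)
      then show ?thesis using that by (auto simp: fs)
    qed
    fix x assume "x \<in> interior_verts T"
    then show "(\<Sum>y \<in> parcs T `` {x}. f x - f y) = (a + mu) * f x"
      unfolding I slp_core_2
    proof (elim UnE imageE insertE emptyE; hypsubst)
      have "(\<Sum>y \<in> parcs T `` {Spine 0}. f (Spine 0) - f y)
          = (1 - c) + m * (1 - r) + (a + 1) * 1"
        unfolding T_def SLP_neighbours_spine fs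
        by (subst sum.union_disjoint, (auto)[3])+ (simp add: P L fs del: One_nat_def)
      then show "(\<Sum>y \<in> parcs T `` {Spine 0}. f (Spine 0) - f y) = (a + mu) * f (Spine 0)"
        using hub by (simp add: fs algebra_simps)
      have "(\<Sum>y \<in> parcs T `` {Spine 1}. f (Spine 1) - f y) = 2 * (c - 1) + a * c"
        unfolding T_def SLP_neighbours_spine fs
        by (subst sum.union_disjoint, (auto)[3]) (simp add: P L fs del: One_nat_def)
      then show "(\<Sum>y \<in> parcs T `` {Spine 1}. f (Spine 1) - f y) = (a + mu) * f (Spine 1)"
        using step by (simp add: fs distrib_right del: One_nat_def)
      have "(\<Sum>y \<in> parcs T `` {Spine 2}. f (Spine 2) - f y)
          = (1 - c) + m * (1 - r) + (a + 1) * 1"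
        unfolding T_def SLP_neighbours_spine fs
        by (subst sum.union_disjoint, (auto)[3])+ (simp add: P L fs del: One_nat_def)
      then show "(\<Sum>y \<in> parcs T `` {Spine 2}. f (Spine 2) - f y) = (a + mu) * f (Spine 2)"
        using hub by (simp add: fs algebra_simps)
    next
      fix i assume i: "i \<in> {1..m}"
      have "(\<Sum>y \<in> parcs T `` {ArmL i}. f (ArmL i) - f y) = (r - 1) + a * r"
        unfolding T_def SLP_neighbours_arm(1)[OF i] fs
        by (subst sum.union_disjoint, (auto)[3]) (simp add: P fs del: One_nat_def)
      then show "(\<Sum>y \<in> parcs T `` {ArmL i}. f (ArmL i) - f y) = (a + mu) * f (ArmL i)"
        using step by (simp add: fs distrib_right del: One_nat_def)
      have "(\<Sum>y \<in> parcs T `` {ArmR i}. f (ArmR i) - f y) = (r - 1) + a * r"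
        unfolding T_def SLP_neighbours_arm(2)[OF i] fs
        by (subst sum.union_disjoint, (auto)[3]) (simp add: P fs del: One_nat_def)
      then show "(\<Sum>y \<in> parcs T `` {ArmR i}. f (ArmR i) - f y) = (a + mu) * f (ArmR i)"
        using step by (simp add: fs distrib_right del: One_nat_def)
    qed
  qed
  then show ?thesis by (simp add: T_def)
qed

section \<open>Isomorphisms and invariance of the eigenvalue\<close>

lemma digraph_iso_with_projI:
  assumes "pair_wf_digraph G" "inj_on h (pverts G)" "pverts H = h ` pverts G"
    "parcs H = map_prod h h ` parcs G"
  shows "digraph_iso (with_proj G) (with_proj H)"
proof -
  interpret pair_wf_digraph G by fact
  let ?hom = "\<lparr> iso_verts = h, iso_arcs = map_prod h h, iso_head = snd, iso_tail = fst \<rparr>"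
  have "parcs G \<subseteq> pverts G \<times> pverts G" using in_arcsD1 in_arcsD2 by auto
  then have "inj_on (map_prod h h) (parcs G)"
    using map_prod_inj_on[OF assms(2) assms(2)] inj_on_subset by blast
  then have "pre_digraph.digraph_isomorphism (with_proj G) ?hom"
    using assms wf_digraph_axioms by (auto simp: pre_digraph.digraph_isomorphism_def)
  moreover have "with_proj H = app_iso ?hom (with_proj G)"
    using assms by (simp add: app_iso_def with_proj_def)
  ultimately show ?thesis by (auto simp: digraph_iso_def)
qed

text \<open>An arc of a pair digraph is its pair of endpoints, so the vertex map determines the arc
  map.\<close>

lemma digraph_iso_with_projE:
  assumes "digraph_iso (with_proj G) (with_proj H)"
  obtains h where "inj_on h (pverts G)" "pverts H = h ` pverts G" "parcs H = map_prod h h ` parcs G"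
proof -
  obtain hom where hom: "pre_digraph.digraph_isomorphism (with_proj G) hom"
    "with_proj H = app_iso hom (with_proj G)"
    using assms by (auto simp: digraph_iso_def)
  have eq: "pverts H = iso_verts hom ` pverts G" "parcs H = iso_arcs hom ` parcs G"
    "iso_tail hom = fst" "iso_head hom = snd"
    using hom(2) by (auto simp: app_iso_def with_proj_def)
  have "iso_arcs hom e = map_prod (iso_verts hom) (iso_verts hom) e" if "e \<in> parcs G" for e
    using hom(1) that eq(3,4) by (auto simp: pre_digraph.digraph_isomorphism_def prod_eq_iff)
  then have "parcs H = map_prod (iso_verts hom) (iso_verts hom) ` parcs G"
    unfolding eq(2) by (rule image_cong[OF refl])
  moreover have "inj_on (iso_verts hom) (pverts G)"
    using hom(1) by (simp add: pre_digraph.digraph_isomorphism_def)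
  ultimately show thesis using that eq(1) by blast
qed

text \<open>Eigenfunctions are composed with the vertex bijection, which needs no inverse map; the
  converse comes from the swapped isomorphism.\<close>

lemma dirichlet_eigenvalue_pullback:
  assumes wf: "pair_wf_digraph G" and iso: "digraph_iso (with_proj G) (with_proj H)"
    and "dirichlet_eigenvalue H lam"
  shows "dirichlet_eigenvalue G lam"
proof -
  interpret pair_wf_digraph G by (rule wf)
  obtain h where h: "inj_on h (pverts G)" "pverts H = h ` pverts G" "parcs H = map_prod h h ` parcs G"
    using digraph_iso_with_projE[OF iso] .
  have nb: "parcs H `` {h x} = h ` (parcs G `` {x})" "inj_on h (parcs G `` {x})" if "x \<in> pverts G" for x
  proof -
    have "z = x" if "(z, y) \<in> parcs G" "h z = h x" for z y
      using that \<open>x \<in> pverts G\<close> in_arcsD1 inj_onD[OF h(1)] by blast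
    then show "parcs H `` {h x} = h ` (parcs G `` {x})"
      unfolding h(3) by (force simp: image_iff)
    show "inj_on h (parcs G `` {x})" using in_arcsD2 by (intro inj_on_subset[OF h(1)]) auto
  qed
  have lf: "h x \<in> leaf_verts H \<longleftrightarrow> x \<in> leaf_verts G" if "x \<in> pverts G" for x
    using that h(2) nb[OF that] by (simp add: mem_leaf_verts card_image)
  obtain f where f: "\<exists>x \<in> pverts H. f x \<noteq> 0" "\<forall>x \<in> leaf_verts H. f x = 0"
     "\<forall>x \<in> interior_verts H. (\<Sum>y \<in> parcs H `` {x}. f x - f y) = lam * f x"
    using assms(3) unfolding dirichlet_eigenvalue_alt by blast
  show ?thesis
    unfolding dirichlet_eigenvalue_alt
  proof (intro exI[of _ "f \<circ> h"] conjI ballI)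
    show "\<exists>x \<in> pverts G. (f \<circ> h) x \<noteq> 0" using f(1) h(2) by auto
    show "(f \<circ> h) x = 0" if "x \<in> leaf_verts G" for x
      using that lf[of x] f(2) by (auto simp: mem_leaf_verts)
    fix x assume "x \<in> interior_verts G"
    then have x: "x \<in> pverts G" "x \<notin> leaf_verts G" by (auto simp: interior_verts_def)
    then have "h x \<in> interior_verts H" using lf h(2) by (auto simp: interior_verts_def)
    then have "(\<Sum>y \<in> h ` (parcs G `` {x}). f (h x) - f y) = lam * f (h x)"
      using f(3) unfolding nb(1)[OF x(1), symmetric] by blast
    then show "(\<Sum>y \<in> parcs G `` {x}. (f \<circ> h) x - (f \<circ> h) y) = lam * (f \<circ> h) x"
      by (simp add: sum.reindex[OF nb(2)[OF x(1)]])
  qed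
qed

lemma first_dirichlet_eigenvalue_iso:
  assumes "pair_wf_digraph G" "pair_wf_digraph H" "digraph_iso (with_proj G) (with_proj H)"
  shows "first_dirichlet_eigenvalue G = first_dirichlet_eigenvalue H"
proof -
  interpret pair_wf_digraph G by fact
  have iso': "digraph_iso (with_proj H) (with_proj G)"
    using digraph_iso_swap wf_digraph_axioms assms(3) by blast
  then have "dirichlet_eigenvalue G = dirichlet_eigenvalue H"
    using dirichlet_eigenvalue_pullback[OF assms(1,3)] dirichlet_eigenvalue_pullback[OF assms(2) iso']
    by blast
  then show ?thesis by (simp add: first_dirichlet_eigenvalue_def)
qed

text \<open>A pendant goes to the \<open>i\<close>-th leaf at the image of its vertex. The recursion
  also covers nested pendants, which the datatype allows but the trees do not contain.\<close>

primrec slp_map :: "(nat \<Rightarrow> 'v) \<Rightarrow> (nat \<Rightarrow> 'v) \<Rightarrow> (nat \<Rightarrow> 'v) \<Rightarrow> ('v \<Rightarrow> nat \<Rightarrow> 'v) \<Rightarrow> slp_vertex \<Rightarrow> 'v" where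
  "slp_map sp al ar pe (Spine i) = sp i"
| "slp_map sp al ar pe (ArmL i) = al i"
| "slp_map sp al ar pe (ArmR i) = ar i"
| "slp_map sp al ar pe (Pendant v i) = pe (slp_map sp al ar pe v) i"

lemma inj_on_disjoint_image_Un: "inj_on f B \<Longrightarrow> inj_on f C \<Longrightarrow> f ` B \<inter> f ` C = {} \<Longrightarrow> inj_on f (B \<union> C)"
  by (auto simp: inj_on_Un)

context interior_tree
begin

text \<open>Enumerate both arm sets and the leaves at every vertex, and map the star-like path tree
  onto \<open>T\<close> along these enumerations. Matching leaf counts make the map bijective on
  pendants.\<close>

lemma iso_SLP:
  assumes dist: "distinct [c, x, p]" "L \<inter> L' = {}" "{c, x, p} \<inter> (L \<union> L') = {}" "finite L" "finite L'"
    and I_eq: "I = {c, x, p} \<union> L \<union> L'"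
    and A_eq: "A = ({(c, x), (c, p)} \<union> {x} \<times> L \<union> {p} \<times> L') \<union> ({(c, x), (c, p)} \<union> {x} \<times> L \<union> {p} \<times> L')\<inverse>"
    and cards: "card L = m" "card L' = m" "card (leaves c) = a" "card (leaves x) = a + 1" "card (leaves p) = a + 1"
      "\<forall>z \<in> L \<union> L'. card (leaves z) = a"
  shows "digraph_iso (with_proj (SLP (a + 1) a 2 m m)) (with_proj T)"
proof -
  let ?S = "SLP (a + 1) a 2 m m" and ?C = "slp_core 2 m m" and ?n = "slp_pendants (a + 1) a 2"
  obtain al where al: "bij_betw al {1..m} L"
    using ex_bij_betw_nat_finite_1[OF dist(4)] cards(1) by auto
  obtain ar where ar: "bij_betw ar {1..m} L'"
    using ex_bij_betw_nat_finite_1[OF dist(5)] cards(2) by auto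
  have "\<forall>u. \<exists>g. bij_betw g {1..card (leaves u)} (leaves u)"
    using ex_bij_betw_nat_finite_1[OF fin_leaves] by blast
  then obtain pe where pe: "\<And>u. bij_betw (pe u) {1..card (leaves u)} (leaves u)" by metis
  \<comment> \<open>The middle of the path is \<open>c\<close>, between the hubs \<open>x\<close>
    and \<open>p\<close>.\<close>
  define sp where "sp = (\<lambda>i :: nat. if i = 0 then x else if i = 1 then c else p)"
  define h where "h = slp_map sp al ar pe"
  have hs: "h (Spine 0) = x" "h (Spine 1) = c" "h (Spine 2) = p" by (auto simp: h_def sp_def)
  have hL: "h ` ArmL ` {1..m} = L" using al by (simp add: h_def image_image bij_betw_def)
  have hR: "h ` ArmR ` {1..m} = L'" using ar by (simp add: h_def image_image bij_betw_def)
  have hC: "h ` ?C = I"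
    unfolding slp_core_2 image_Un hL hR I_eq using hs by auto
  have inj_arms: "inj_on h (ArmL ` {1..m})" "inj_on h (ArmR ` {1..m})"
  proof -
    have "h \<circ> ArmL = al" "h \<circ> ArmR = ar" by (auto simp: h_def)
    then show "inj_on h (ArmL ` {1..m})" "inj_on h (ArmR ` {1..m})"
      using al ar by (intro inj_on_imageI; simp add: bij_betw_def)+
  qed
  have "inj_on h ({Spine 0, Spine 1, Spine 2} \<union> ArmL ` {1..m} \<union> ArmR ` {1..m})"
  proof (intro inj_on_disjoint_image_Un inj_arms)
    show "inj_on h {Spine 0, Spine 1, Spine 2}" using dist(1) hs by (auto simp: inj_on_def simp del: One_nat_def)
    show "h ` {Spine 0, Spine 1, Spine 2} \<inter> h ` ArmL ` {1..m} = {}"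
      unfolding hL using dist hs by (auto simp del: One_nat_def)
    show "h ` ({Spine 0, Spine 1, Spine 2} \<union> ArmL ` {1..m}) \<inter> h ` ArmR ` {1..m} = {}"
      unfolding hR image_Un hL using dist hs by (auto simp del: One_nat_def)
  qed
  then have injC: "inj_on h ?C" by (simp add: slp_core_2)
  have n: "?n v = card (leaves (h v))" if "v \<in> ?C" for v
    using that unfolding slp_core_2
  proof (elim UnE imageE insertE emptyE; hypsubst)
    show "?n (Spine 0) = card (leaves (h (Spine 0)))" "?n (Spine 1) = card (leaves (h (Spine 1)))"
      "?n (Spine 2) = card (leaves (h (Spine 2)))"
      unfolding hs using cards by (auto simp: slp_pendants_def)
    show "?n (ArmL i) = card (leaves (h (ArmL i)))" if "i \<in> {1..m}" for i
      using hL cards(6) that by (auto simp: slp_pendants_def)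
    show "?n (ArmR i) = card (leaves (h (ArmR i)))" if "i \<in> {1..m}" for i
      using hR cards(6) that by (auto simp: slp_pendants_def)
  qed
  have hP: "h ` Pendant v ` {1..?n v} = leaves (h v)" if "v \<in> ?C" for v
    using pe[of "h v"] n[OF that] by (simp add: h_def image_image bij_betw_def)
  have injP: "inj_on h (Pendant v ` {1..?n v})" if "v \<in> ?C" for v
  proof (rule inj_on_imageI)
    have "h \<circ> Pendant v = pe (h v)" by (auto simp: h_def)
    then show "inj_on (h \<circ> Pendant v) {1..?n v}"
      using pe[of "h v"] n[OF that] by (simp add: bij_betw_def)
  qed
  have LI: "(\<Union>v \<in> ?C. leaves (h v)) = leaf_verts T"
    using leaves_UN unfolding hC[symmetric] by auto
  have hU: "h ` (\<Union>v \<in> ?C. Pendant v ` {1..?n v}) = leaf_verts T"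
    unfolding image_UN using hP LI by simp
  have "pverts T = h ` pverts ?S"
    unfolding pverts_SLP image_Un hC hU by (rule verts_eq)
  moreover have "inj_on h (pverts ?S)"
    unfolding pverts_SLP
  proof (rule inj_on_disjoint_image_Un[OF injC])
    show "inj_on h (\<Union>v \<in> ?C. Pendant v ` {1..?n v})"
    proof (rule inj_onI)
      fix y z assume y: "y \<in> (\<Union>v \<in> ?C. Pendant v ` {1..?n v})" and z: "z \<in> (\<Union>v \<in> ?C. Pendant v ` {1..?n v})"
        and eq: "h y = h z"
      obtain u where u: "u \<in> ?C" "y \<in> Pendant u ` {1..?n u}" using y by blast
      obtain v where v: "v \<in> ?C" "z \<in> Pendant v ` {1..?n v}" using z by blast
      have "h y \<in> leaves (h u)" unfolding hP[OF u(1), symmetric] using u(2) by (rule imageI)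
      moreover have "h y \<in> leaves (h v)" unfolding hP[OF v(1), symmetric] eq using v(2) by (rule imageI)
      moreover have "h u \<in> I" "h v \<in> I" using u v hC by auto
      ultimately have "h u = h v" using leaves_disjoint by blast
      then have "u = v" using injC u v by (auto dest: inj_onD)
      then show "y = z" using inj_onD[OF injP[OF u(1)] eq] u(2) v(2) by blast
    qed
    show "h ` ?C \<inter> h ` (\<Union>v \<in> ?C. Pendant v ` {1..?n v}) = {}"
      unfolding hC hU by (rule interior_leaf_disjoint)
  qed
  moreover have "R = map_prod h h ` parcs ?S"
  proof -
    \<comment> \<open>The edge between \<open>x\<close> and \<open>c\<close> is oriented as in
      \<open>slp_edges\<close>, opposite to \<open>A_eq\<close>; the difference disappears on adding
      converses.\<close>
    let ?E = "{(x, c), (c, p)} \<union> {x} \<times> L \<union> {p} \<times> L' \<union> (SIGMA u:I. leaves u)"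
    have "map_prod h h ` (SIGMA v:?C. Pendant v ` {1..?n v}) = (SIGMA u:I. leaves u)"
    proof -
      have "map_prod h h ` (SIGMA v:?C. Pendant v ` {1..?n v})
          = (\<Union>v \<in> ?C. {h v} \<times> h ` Pendant v ` {1..?n v})"
        by (force simp: image_iff)
      also have "\<dots> = (\<Union>v \<in> ?C. {h v} \<times> leaves (h v))" using hP by simp
      also have "\<dots> = (SIGMA u:I. leaves u)" unfolding hC[symmetric] by auto
      finally show ?thesis .
    qed
    moreover have "map_prod h h ` ({Spine 0} \<times> ArmL ` {1..m}) = {x} \<times> L"
      "map_prod h h ` ({Spine 2} \<times> ArmR ` {1..m}) = {p} \<times> L'"
      unfolding map_prod_surj_on[OF refl refl] hL hR using hs by simp_all
    ultimately have E: "map_prod h h ` slp_edges (a + 1) a 2 m m = ?E"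
      unfolding slp_edges_2 image_Un using hs by simp
    have R_eq: "R = ?E \<union> ?E\<inverse>"
    proof -
      have "R = A \<union> (SIGMA u:I. leaves u) \<union> (SIGMA u:I. leaves u)\<inverse>"
      proof (intro equalityI subsetI)
        fix e assume e: "e \<in> R"
        obtain u w where uw: "e = (u, w)" by (cases e)
        have uwV: "u \<in> I \<union> leaf_verts T" "w \<in> I \<union> leaf_verts T"
          using R_sub e uw unfolding verts_eq by auto
        show "e \<in> A \<union> (SIGMA u:I. leaves u) \<union> (SIGMA u:I. leaves u)\<inverse>"
        proof (cases "u \<in> I")
          case True then show ?thesis using uw e uwV by (auto simp: A_def leaves_def)
        next
          case False
          then have u: "u \<in> leaf_verts T" using uwV by auto
          then obtain u' where "u' \<in> I" "R `` {u} = {u'}" by (rule leaf_neighbour)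
          then have "w \<in> I" using uw e by auto
          then show ?thesis using u uw e R_sym[of u w] by (auto simp: leaves_def)
        qed
      next
        fix e assume "e \<in> A \<union> (SIGMA u:I. leaves u) \<union> (SIGMA u:I. leaves u)\<inverse>"
        then show "e \<in> R" using R_sym by (auto simp: A_def leaves_def)
      qed
      also have "\<dots> = ?E \<union> ?E\<inverse>" unfolding A_eq by auto
      finally show ?thesis .
    qed
    have conv: "map_prod h h ` (B \<union> B\<inverse>) = map_prod h h ` B \<union> (map_prod h h ` B)\<inverse>" for B
      by (force simp: image_iff)
    have "parcs ?S = slp_edges (a + 1) a 2 m m \<union> (slp_edges (a + 1) a 2 m m)\<inverse>"
      by (simp add: SLP_def)
    then show ?thesis by (simp only: conv E R_eq)
  qed
  ultimately show ?thesis by (intro digraph_iso_with_projI wf_SLP)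
qed

end

theorem theorem3p11:
  fixes a k b :: nat and T :: "'v pair_pre_digraph"
  assumes "a \<ge> 1" and "k \<ge> 5" and "odd k" and "b = a * k + 2"
    and "undirected_tree T"
    and "card (interior_verts T) = k" and "card (leaf_verts T) = b"
  shows "first_dirichlet_eigenvalue T
           \<le> first_dirichlet_eigenvalue (SLP (a + 1) a 2 ((k - 3) div 2) ((k - 3) div 2)) \<and>
         (first_dirichlet_eigenvalue T
           = first_dirichlet_eigenvalue (SLP (a + 1) a 2 ((k - 3) div 2) ((k - 3) div 2))
          \<longleftrightarrow> digraph_iso (with_proj T) (with_proj (SLP (a + 1) a 2 ((k - 3) div 2) ((k - 3) div 2))))"
proof -
  define m where "m = (k - 3) div 2"
  \<comment> \<open>Oddness of \<open>k\<close> makes the division by 2 exact.\<close>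
  have k: "k = 2 * m + 3" using assms(2,3) by (auto simp: m_def elim!: oddE)
  let ?S = "SLP (a + 1) a 2 m m"
  have "interior_verts T \<noteq> {}" using assms(2,6) by auto
  then interpret interior_tree T using assms(5) by unfold_locales
  obtain mu where mu: "0 < mu" "mu < 1" "bound_fun k mu = 2"
    using bound_fun_root[of k] assms(2) by auto
  have S: "first_dirichlet_eigenvalue ?S = a + mu"
    by (rule SLP_first_eigenvalue[OF assms(1) k mu])
  have leafs: "card (leaf_verts T) = a * k + 2" using assms(4,7) by simp
  note bound = first_eigenvalue_bound[OF assms(6,2) leafs mu]
  have wf: "wf_digraph (with_proj ?S)" "pair_wf_digraph T"
    using wf_SLP[of "a + 1" a 2 m m] G.pair_wf_digraph_axioms by (simp_all add: wf_digraph_wp_iff)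
  have "digraph_iso (with_proj T) (with_proj ?S)" if eq: "first_dirichlet_eigenvalue T = a + mu"
  proof -
    obtain c x p L L' where st: "distinct [c, x, p]" "finite L" "finite L'" "L \<inter> L' = {}"
      "{c, x, p} \<inter> (L \<union> L') = {}" "I = {c, x, p} \<union> L \<union> L'"
      "A = ({(c, x), (c, p)} \<union> {x} \<times> L \<union> {p} \<times> L') \<union> ({(c, x), (c, p)} \<union> {x} \<times> L \<union> {p} \<times> L')\<inverse>"
      "card L = card L'" "card (leaves c) = a" "card (leaves x) = a + 1" "card (leaves p) = a + 1"
      "\<forall>z \<in> L \<union> L'. card (leaves z) = a"
      using bound(2)[OF eq] by (elim exE conjE)
    have "card ({c, x, p} \<union> L) = card {c, x, p} + card L"
      by (rule card_Un_disjoint) (use st(2,5) in auto)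
    moreover have "card I = card ({c, x, p} \<union> L) + card L'"
      unfolding st(6) by (rule card_Un_disjoint) (use st(2-5) in auto)
    ultimately have "card I = card {c, x, p} + card L + card L'" by simp
    \<comment> \<open>The interior has \<open>3 + 2 * card L\<close> vertices, as both arm sets have
      the same size.\<close>
    then have "card L = m" "card L' = m" using assms(6) k st(1,8) by auto
    then have "digraph_iso (with_proj ?S) (with_proj T)"
      by (intro iso_SLP[of c x p L L']) (use st in auto)
    then show ?thesis by (rule digraph_iso_swap[OF wf(1)])
  qed
  moreover have "first_dirichlet_eigenvalue T = a + mu" if "digraph_iso (with_proj T) (with_proj ?S)"
    using first_dirichlet_eigenvalue_iso[OF wf(2) wf_SLP that] S by simp
  ultimately show ?thesis
    using bound(1) S unfolding m_def[symmetric] by auto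
qed

end
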